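(* Let $\Omega_v=\{X_1,\dots,X_n\}$ and $\Omega_p=\{P_1,\dots,P_m\}$, $\Omega=(\Omega_v,\Omega_p)$. Let $I$ be the system of inequalities $(X_i\geq\varphi_i)_{i=1}^n$, where $\varphi_1,\dots,\varphi_n\in\mathbb P[\Omega]$. Then the Gaussian elimination-inspired algorithm below is a finite procedure to compute $\varphi_1^*,\dots,\varphi_n^*\in\mathbb P[(\emptyset,\Omega_p)]$ with the guarantee that $$\operatorname{ss}(I;\mathbf P)(X_j)=\operatorname{conv}\bigl(\operatorname{eval}(\varphi_j^*;\mathbf P)\bigr)$$ for every $j\in\{1,2,\dots,n\}$ and every assignment $\mathbf P\in(2^V)^{\Omega_p}$. Algorithm. 1. Initialize $I^{(0)}=I$, i.e. $\varphi_i^{(0)}=\varphi_i$. 2. For $j=1,2,\dots,n$: (a) $I^{(j-1)}$ is the system $\{X_i\geq\varphi_i^{(j-1)}\}_{i=1}^n$, each $\varphi_i^{(j-1)}$ being a polynomial over $(\{X_j,\dots,X_n\},\{P_1,\dots,P_m\})$. (b) (Canceling $X_j$.) Apply rearrangement and then cancellation (both defined in the context) to the inequality $X_j\geq\varphi_j^{(j-1)}$, obtaining a polynomial $\widetilde\varphi$ over $(\Omega_v\setminus\{X_1,\dots,X_j\},\Omega_p)$; replace $X_j\geq\varphi_j^{(j-1)}$ by $X_j\geq\widetilde\varphi$. (c) (Substituting $X_j$.) Let $I^{(j)}$ be the system $\{X_i\geq\varphi_i^{(j)}\}_{i=1}^n$, where $\varphi_j^{(j)}=\widetilde\varphi$ and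 $\varphi_i^{(j)}=\varphi_i^{(j-1)}\llbracket X_j\gets\widetilde\varphi\rrbracket$ for $i\neq j$ (substitution is defined in the context). 3. The computed polynomials are $\varphi_i^*=\varphi_i^{(n)}$, $1\le i\le n$; for an assignment $\mathbf P$ of the parameters, output $\mathbf X\in\mathcal C(V)^n$ with $\mathbf X_i=\operatorname{conv}(\operatorname{eval}(\varphi_i^{(n)};\mathbf P))$.
   Context: $V$ is a finite-dimensional real vector space, $2^V$ its set of subsets, $\mathcal C(V)$ its set of convex subsets (including $\emptyset$), $\operatorname{conv}$ the convex hull. For $A,B\subset V$ and $\rho\in\mathbb R$: $\rho\cdot A=\{\rho x: x\in A\}$; $A+B=\{a+b: a\in A,b\in B\}$; $A\,\widehat\oplus\,B=A\cup B$; and the positive geometric join is $A\,\mathring\star\,B=\{\lambda a+(1-\lambda)b: 0<\lambda<1,\ a\in A,\ b\in B\}$ (associative and commutative). Syntax. $\Omega_v$ (variables) and $\Omega_p$ (parameters) are disjoint finite sets of symbols, $\Omega=(\Omega_v,\Omega_p)$. $\mathrm{CL}(\Omega)$ is the set of formal convex linear combinations $E=\sum_{\omega\in\Omega_v\cup\Omega_p}\lambda_\omega\cdot\omega$ with $\lambda_\omega\geq0$, $\sum\lambda_\omega=1$. A monomial over $\Omega$ is a formal product $M=E_1\mathring\star\cdots\mathring\star E_k$, $k\geq1$, of distinct elements of $\mathrm{CL}(\Omega)$, up to permutation of factors (formally $E\mathring\star E=E$); $\mathrm{supp}(M)=\{E_1,\dots,E_k\}$. A polynomial over $\Omega$ is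 a formal sum $\varphi=M_1\widehat\oplus\cdots\widehat\oplus M_k$, $k\geq0$, of distinct monomials, up to permutation (formally $M\widehat\oplus M=M$); $\mathrm{mono}(\varphi)=\{M_1,\dots,M_k\}$, and $\mathbb 0$ is the polynomial with $k=0$. $\mathbb P[\Omega]$ is the set of polynomials; $\mathbb P[(\emptyset,\Omega_p)]$ consists of polynomials involving parameters only. Evaluation. For $\mathbf X\in\mathcal C(V)^{\Omega_v}$ and $\mathbf P\in(2^V)^{\Omega_p}$: $\operatorname{eval}(E;\mathbf X,\mathbf P)=\sum_{X\in\Omega_v,\lambda_X>0}\lambda_X\cdot\mathbf X(X)+\sum_{P\in\Omega_p,\lambda_P>0}\lambda_P\cdot\mathbf P(P)$ (Minkowski sums); for a monomial, $\operatorname{eval}$ is the positive geometric join of the evaluations of its distinct factors; for a polynomial, the union of the evaluations of its monomials ($\mathbb 0$ evaluates to $\emptyset$). For $\varphi\in\mathbb P[(\emptyset,\Omega_p)]$ we write $\operatorname{eval}(\varphi;\mathbf P)$. Solutions. $\mathbf X\in\mathcal C(V)^{\Omega_v}$ is a solution of $I$ under $\mathbf P$ if $\mathbf X(X_i)\supseteq\operatorname{eval}(\varphi_i;\mathbf X,\mathbf P)$ for all $i$. $\operatorname{ss}(I;\mathbf P)$ is the smallest solution, i.e. the componentwise intersection of all solutions (it is always itself a solution). Operations used in the algorithm. Fix a variable $X$; say that $E\in\mathrm{CL}(\Omega)$, or a monomial, involves $X$ if $X$ has positive coefficient in $E$, respectively in some factor of the monomial. Let $\Omega'=(\Omega_v\setminus\{X\},\Omega_p)$.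 Rearrangement of $X\geq\varphi$: first drop from $\varphi$ the monomial $X$ (if present). Let $\varphi'\in\mathbb P[\Omega']$ be the sum of the monomials of $\varphi$ not involving $X$, and let $N_1,\dots,N_k$ be the remaining monomials. In $N_i$ write each factor involving $X$ as $\rho\cdot X+(1-\rho)\cdot E$ with $0<\rho\le1$, $E\in\mathrm{CL}(\Omega')$, and let $M_i$ be the monomial over $\Omega'$ that is the $\mathring\star$-product of all these $E$ with $\rho<1$ and of all factors of $N_i$ not involving $X$. The rearranged inequality is $X\geq\varphi'\,\widehat\oplus\,X\mathring\star M_1\,\widehat\oplus\cdots\widehat\oplus\,X\mathring\star M_k$; for every assignment it holds if and only if $X\geq\varphi$ holds. Cancellation: writing $\varphi'=\widehat\bigoplus_{i=1}^{k'}M_i'$ with monomials $M_i'$ over $\Omega'$, the rearranged inequality is replaced by $X\geq\widetilde\varphi$ with $\widetilde\varphi=\widehat\bigoplus_{i=1}^{k'}\bigl(M_i'\,\widehat\oplus\,\widehat\bigoplus_{j=1}^{k}M_i'\mathring\star M_j\bigr)\in\mathbb P[\Omega']$. Substitution of $\varphi_X\in\mathbb P[\Omega']$ for $X$: for $E=\rho\cdot X+(1-\rho)\cdot E'$ with $0\le\rho\le1$, $E'\in\mathrm{CL}(\Omega')$, and $F\in\mathrm{CL}(\Omega')$, put $E\llbracket X\gets F\rrbracket=\rho\cdot F+(1-\rho)\cdot E'$. For a monomial $M$ let $D(M)$ be the set of factors $E\in\mathrm{supp}(M)$ involving $X$. Then $M\llbracket X\gets\varphi_X\rrbracket$ is $M$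 if $D(M)=\emptyset$; it is $\mathbb 0$ if $D(M)\neq\emptyset$ and $\varphi_X=\mathbb 0$; otherwise it is the $\widehat\oplus$-sum over all functions $\vec N:D(M)\to\mathrm{mono}(\varphi_X)$ of the monomials obtained as the $\mathring\star$-product of all $E\in\mathrm{supp}(M)\setminus D(M)$ and of all $E\llbracket X\gets F\rrbracket$ with $E\in D(M)$, $F\in\mathrm{supp}(\vec N(E))$. For a polynomial, $\varphi\llbracket X\gets\varphi_X\rrbracket=\widehat\bigoplus_{M\in\mathrm{mono}(\varphi)}M\llbracket X\gets\varphi_X\rrbracket\in\mathbb P[\Omega']$. At stage $j$ of the algorithm these operations are applied with $X=X_j$ and with $\{X_j,\dots,X_n\}$ as the set of variables. *)

theory Defs
  imports "HOL-Analysis.Analysis"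
begin

section \<open>Positive geometric join\<close>

definition gjoin :: "'a::real_vector set \<Rightarrow> 'a set \<Rightarrow> 'a set"  (infixr "\<star>" 70)
  where "A \<star> B = {l *\<^sub>R a + (1 - l) *\<^sub>R b | l a b. 0 < l \<and> l < 1 \<and> a \<in> A \<and> b \<in> B}"

lemma gjoin_commute: "A \<star> B = B \<star> A"
proof -
  have "A \<star> B \<subseteq> B \<star> A" for A B :: "'a set"
  proof
    fix x assume "x \<in> A \<star> B"
    then obtain l a b where *: "0 < l" "l < 1" "a \<in> A" "b \<in> B" "x = l *\<^sub>R a + (1 - l) *\<^sub>R b"
      by (auto simp: gjoin_def)
    have "x = (1 - l) *\<^sub>R b + (1 - (1 - l)) *\<^sub>R a"
      using * by simp
    moreover have "0 < 1 - l" "1 - l < 1" using * by auto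
    ultimately show "x \<in> B \<star> A"
      using * unfolding gjoin_def by blast
  qed
  then show ?thesis by blast
qed

lemma gjoin_left_commute: "A \<star> (B \<star> C) = B \<star> (A \<star> C)"
proof -
  have "A \<star> (B \<star> C) \<subseteq> B \<star> (A \<star> C)" for A B C :: "'a set"
  proof
    fix x assume "x \<in> A \<star> (B \<star> C)"
    then obtain l m a b c where *: "0 < l" "l < 1" "0 < m" "m < 1" "a \<in> A" "b \<in> B" "c \<in> C"
      "x = l *\<^sub>R a + (1 - l) *\<^sub>R (m *\<^sub>R b + (1 - m) *\<^sub>R c)"
      by (force simp: gjoin_def)
    define k where "k = (1 - l) * m"
    define v where "v = l / (1 - k)"
    have "k < 1 * m" unfolding k_def using * by (intro mult_strict_right_mono) auto
    then have "k < 1" using * by linarith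
    moreover have "0 < k" using * by (simp add: k_def)
    ultimately have k: "0 < k" "k < 1" by auto
    have "1 - k - l = (1 - l) * (1 - m)" by (simp add: k_def algebra_simps)
    moreover have "0 < (1 - l) * (1 - m)" using * by simp
    ultimately have "l < 1 - k" by linarith
    then have v: "0 < v" "v < 1" using k * by (auto simp: v_def)
    have "(1 - k) * v = l" using k by (simp add: v_def)
    moreover from this have "(1 - k) * (1 - v) = (1 - l) * (1 - m)"
      by (simp add: k_def algebra_simps)
    ultimately have "x = k *\<^sub>R b + (1 - k) *\<^sub>R (v *\<^sub>R a + (1 - v) *\<^sub>R c)"
      using * by (simp add: k_def scaleR_add_right)
    moreover have "v *\<^sub>R a + (1 - v) *\<^sub>R c \<in> A \<star> C"
      using v * unfolding gjoin_def by blast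
    ultimately show "x \<in> B \<star> (A \<star> C)"
      using k * unfolding gjoin_def by blast
  qed
  then show ?thesis by blast
qed

lemma gjoin_assoc: "(A \<star> B) \<star> C = A \<star> (B \<star> C)"
  by (metis gjoin_commute gjoin_left_commute)

text \<open>
  The join has no neutral element, so the iterated join over a finite nonempty set is folded
  from \<^const>\<open>None\<close>; the lemmas below give its recursion equations.
\<close>

definition big_gjoin :: "('e \<Rightarrow> 'a::real_vector set) \<Rightarrow> 'e set \<Rightarrow> 'a set"
  where "big_gjoin f S =
    the (Finite_Set.fold (\<lambda>e r. Some (case r of None \<Rightarrow> f e | Some B \<Rightarrow> f e \<star> B)) None S)"

lemma big_gjoin_singleton: "big_gjoin f {e} = f e"
  and big_gjoin_insert:
    "finite S \<Longrightarrow> S \<noteq> {} \<Longrightarrow> e \<notin> S \<Longrightarrow> big_gjoin f (insert e S) = f e \<star> big_gjoin f S"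
proof -
  interpret comp_fun_commute "\<lambda>e r. Some (case r of None \<Rightarrow> f e | Some B \<Rightarrow> f e \<star> B)"
    by standard
      (auto simp: fun_eq_iff gjoin_left_commute gjoin_commute split: option.splits)
  show "big_gjoin f {e} = f e"
    by (simp add: big_gjoin_def)
  assume S: "finite S" "S \<noteq> {}" "e \<notin> S"
  then obtain e' where "e' \<in> S" by blast
  then have "Finite_Set.fold (\<lambda>e r. Some (case r of None \<Rightarrow> f e | Some B \<Rightarrow> f e \<star> B)) None S \<noteq> None"
    using S fold_rec[of S e' None] by simp
  then show "big_gjoin f (insert e S) = f e \<star> big_gjoin f S"
    using S by (auto simp: big_gjoin_def)
qed

lemma big_gjoin_mono:
  assumes "finite S" "S \<noteq> {}" "\<And>e. e \<in> S \<Longrightarrow> f e \<subseteq> g e"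
  shows "big_gjoin f S \<subseteq> big_gjoin g S"
  using assms
proof (induction S rule: finite_ne_induct)
  case (singleton e)
  then show ?case by (simp add: big_gjoin_singleton)
next
  case (insert e S)
  then have "f e \<subseteq> g e" "big_gjoin f S \<subseteq> big_gjoin g S" by auto
  then show ?case
    using insert.hyps by (simp add: big_gjoin_insert gjoin_def) blast
qed


section \<open>Syntax\<close>

text \<open>
  Since products and sums are formal, commutative and idempotent, a monomial is the finite
  nonempty set of its factors and a polynomial is the finite set of its monomials. Hence the
  formal join of two monomials, the formal sum of two polynomials and the zero polynomial are
  \<open>\<union>\<close>, \<open>\<union>\<close> and \<open>{}\<close>.
\<close>

type_synonym 's lincomb = "'s \<Rightarrow> real"
type_synonym 's monomial = "'s lincomb set"
type_synonym 's polynomial = "'s monomial set"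

definition CL :: "'s set \<Rightarrow> 's set \<Rightarrow> 's lincomb set"
  where "CL \<Omega>v \<Omega>p = {E. (\<forall>\<omega>. 0 \<le> E \<omega>) \<and> (\<forall>\<omega>. \<omega> \<notin> \<Omega>v \<union> \<Omega>p \<longrightarrow> E \<omega> = 0) \<and>
    (\<Sum>\<omega>\<in>\<Omega>v \<union> \<Omega>p. E \<omega>) = 1}"

definition monomials :: "'s set \<Rightarrow> 's set \<Rightarrow> 's monomial set"
  where "monomials \<Omega>v \<Omega>p = {M. finite M \<and> M \<noteq> {} \<and> M \<subseteq> CL \<Omega>v \<Omega>p}"

definition polynomials :: "'s set \<Rightarrow> 's set \<Rightarrow> 's polynomial set"
  where "polynomials \<Omega>v \<Omega>p = {\<phi>. finite \<phi> \<and> \<phi> \<subseteq> monomials \<Omega>v \<Omega>p}"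

definition unit_comb :: "'s \<Rightarrow> 's lincomb"
  where "unit_comb x = (\<lambda>\<omega>. if \<omega> = x then 1 else 0)"


section \<open>Evaluation\<close>

text \<open>
  Sums and \<open>+\<close> of sets are Minkowski sums; the empty sum is \<open>{0}\<close>. Assignments are total
  functions, but \<open>X\<close> is only read on \<open>\<Omega>v\<close> and \<open>P\<close> only on \<open>\<Omega>p\<close>.
\<close>

definition eval_comb ::
    "'s set \<Rightarrow> 's set \<Rightarrow> ('s \<Rightarrow> 'a::real_vector set) \<Rightarrow> ('s \<Rightarrow> 'a set) \<Rightarrow> 's lincomb \<Rightarrow> 'a set"
  where "eval_comb \<Omega>v \<Omega>p X P E =
    (\<Sum>x\<in>{x \<in> \<Omega>v. 0 < E x}. (\<lambda>u. E x *\<^sub>R u) ` X x) +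
    (\<Sum>p\<in>{p \<in> \<Omega>p. 0 < E p}. (\<lambda>u. E p *\<^sub>R u) ` P p)"

definition eval_mono ::
    "'s set \<Rightarrow> 's set \<Rightarrow> ('s \<Rightarrow> 'a::real_vector set) \<Rightarrow> ('s \<Rightarrow> 'a set) \<Rightarrow> 's monomial \<Rightarrow> 'a set"
  where "eval_mono \<Omega>v \<Omega>p X P M = big_gjoin (eval_comb \<Omega>v \<Omega>p X P) M"

definition eval_poly ::
    "'s set \<Rightarrow> 's set \<Rightarrow> ('s \<Rightarrow> 'a::real_vector set) \<Rightarrow> ('s \<Rightarrow> 'a set) \<Rightarrow> 's polynomial \<Rightarrow> 'a set"
  where "eval_poly \<Omega>v \<Omega>p X P \<phi> = (\<Union>M\<in>\<phi>. eval_mono \<Omega>v \<Omega>p X P M)"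

text \<open>Evaluation of a polynomial in parameters only; the variable assignment is never read.\<close>

abbreviation eval_par ::
    "'s set \<Rightarrow> ('s \<Rightarrow> 'a::real_vector set) \<Rightarrow> 's polynomial \<Rightarrow> 'a set"
  where "eval_par \<Omega>p P \<phi> \<equiv> eval_poly {} \<Omega>p (\<lambda>_. {}) P \<phi>"


section \<open>Systems of inequalities and their smallest solution\<close>

text \<open>
  A system with variables \<open>\<Omega>v\<close> has one inequality \<open>x \<ge> I x\<close> for each \<open>x \<in> \<Omega>v\<close>; values of
  \<open>I\<close> outside \<open>\<Omega>v\<close> are irrelevant.
\<close>

type_synonym 's system = "'s \<Rightarrow> 's polynomial"

definition is_solution ::
    "'s set \<Rightarrow> 's set \<Rightarrow> 's system \<Rightarrow> ('s \<Rightarrow> 'a::real_vector set) \<Rightarrow> ('s \<Rightarrow> 'a set) \<Rightarrow> bool"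
  where "is_solution \<Omega>v \<Omega>p I P X \<longleftrightarrow>
    (\<forall>x\<in>\<Omega>v. convex (X x)) \<and> (\<forall>x\<in>\<Omega>v. eval_poly \<Omega>v \<Omega>p X P (I x) \<subseteq> X x)"

definition ss ::
    "'s set \<Rightarrow> 's set \<Rightarrow> 's system \<Rightarrow> ('s \<Rightarrow> 'a::real_vector set) \<Rightarrow> 's \<Rightarrow> 'a set"
  where "ss \<Omega>v \<Omega>p I P x = (\<Inter>X\<in>{X. is_solution \<Omega>v \<Omega>p I P X}. X x)"

lemma eval_comb_mono:
  fixes X Y P :: "'s \<Rightarrow> 'a::real_vector set"
  assumes "\<And>x. x \<in> \<Omega>v \<Longrightarrow> X x \<subseteq> Y x"
  shows "eval_comb \<Omega>v \<Omega>p X P E \<subseteq> eval_comb \<Omega>v \<Omega>p Y P E"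
proof -
  have sum_mono: "sum f S \<subseteq> sum g S" if "\<And>x. x \<in> S \<Longrightarrow> f x \<subseteq> g x"
    for f g :: "'s \<Rightarrow> 'a set" and S
    using that by (induction S rule: infinite_finite_induct) (simp_all add: set_plus_mono2)
  show ?thesis
    unfolding eval_comb_def
    by (intro set_plus_mono2 sum_mono image_mono) (simp_all add: assms)
qed

lemma eval_poly_mono:
  assumes "\<phi> \<in> polynomials \<Omega>v \<Omega>p" "\<And>x. x \<in> \<Omega>v \<Longrightarrow> X x \<subseteq> Y x"
  shows "eval_poly \<Omega>v \<Omega>p X P \<phi> \<subseteq> eval_poly \<Omega>v \<Omega>p Y P \<phi>"
  unfolding eval_poly_def eval_mono_def using assms
  by (intro UN_mono big_gjoin_mono eval_comb_mono)
     (auto simp: polynomials_def monomials_def)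

lemma ss_is_solution:
  assumes "\<And>x. x \<in> \<Omega>v \<Longrightarrow> I x \<in> polynomials \<Omega>v \<Omega>p"
  shows "is_solution \<Omega>v \<Omega>p I P (ss \<Omega>v \<Omega>p I P)"
  unfolding is_solution_def
proof (intro conjI ballI)
  fix x assume x: "x \<in> \<Omega>v"
  show "convex (ss \<Omega>v \<Omega>p I P x)"
    unfolding ss_def using x by (intro convex_INT) (auto simp: is_solution_def)
  show "eval_poly \<Omega>v \<Omega>p (ss \<Omega>v \<Omega>p I P) P (I x) \<subseteq> ss \<Omega>v \<Omega>p I P x"
  proof -
    have "eval_poly \<Omega>v \<Omega>p (ss \<Omega>v \<Omega>p I P) P (I x) \<subseteq> X x"
      if X: "is_solution \<Omega>v \<Omega>p I P X" for X
    proof -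
      have "eval_poly \<Omega>v \<Omega>p (ss \<Omega>v \<Omega>p I P) P (I x) \<subseteq> eval_poly \<Omega>v \<Omega>p X P (I x)"
        using X by (intro eval_poly_mono assms x) (auto simp: ss_def)
      then show ?thesis using X x by (auto simp: is_solution_def)
    qed
    then show ?thesis by (auto simp: ss_def)
  qed
qed


section \<open>Rearrangement, cancellation and substitution\<close>

definition involves :: "'s \<Rightarrow> 's monomial \<Rightarrow> bool"
  where "involves x M \<longleftrightarrow> (\<exists>E\<in>M. 0 < E x)"

text \<open>
  For \<open>E = \<rho> \<cdot> x + (1 - \<rho>) \<cdot> E'\<close> with \<open>\<rho> < 1\<close> and \<open>E'\<close> not involving \<open>x\<close>, necessarily
  \<open>\<rho> = E x\<close>, and \<open>residual x E\<close> is the unique such \<open>E'\<close>. If \<open>\<rho> = 1\<close>, then \<open>E'\<close> is arbitrary;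
  here it is 0 and occurs only with coefficient 0.
\<close>

definition residual :: "'s \<Rightarrow> 's lincomb \<Rightarrow> 's lincomb"
  where "residual x E = (\<lambda>\<omega>. if \<omega> = x then 0 else E \<omega> / (1 - E x))"

definition cofactor :: "'s \<Rightarrow> 's monomial \<Rightarrow> 's monomial"
  where "cofactor x N = residual x ` {E \<in> N. 0 < E x \<and> E x < 1} \<union> {E \<in> N. \<not> 0 < E x}"

definition free_part :: "'s \<Rightarrow> 's polynomial \<Rightarrow> 's polynomial"
  where "free_part x \<phi> = {M \<in> \<phi>. \<not> involves x M}"

definition rearrange :: "'s \<Rightarrow> 's polynomial \<Rightarrow> 's polynomial"
  where "rearrange x \<phi> =
    (let \<psi> = \<phi> - {{unit_comb x}}
     in free_part x \<psi> \<union> {{unit_comb x} \<union> cofactor x N | N. N \<in> \<psi> \<and> involves x N})"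

text \<open>
  Applied to a rearranged polynomial \<open>\<phi>' \<union> {{unit_comb x} \<union> M\<^sub>j | j}\<close> with \<open>\<phi>'\<close> and all \<open>M\<^sub>j\<close>
  free of \<open>x\<close>. Removing the factor \<open>unit_comb x\<close> recovers the \<open>M\<^sub>j\<close>.
\<close>

definition cancel :: "'s \<Rightarrow> 's polynomial \<Rightarrow> 's polynomial"
  where "cancel x \<psi> =
    (\<Union>M'\<in>free_part x \<psi>.
       {M'} \<union> {M' \<union> M | M. M \<in> (\<lambda>N. N - {unit_comb x}) ` {N \<in> \<psi>. involves x N}})"

definition subst_comb :: "'s \<Rightarrow> 's lincomb \<Rightarrow> 's lincomb \<Rightarrow> 's lincomb"
  where "subst_comb x F E = (\<lambda>\<omega>. E x * F \<omega> + (1 - E x) * residual x E \<omega>)"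

definition subst_mono :: "'s \<Rightarrow> 's polynomial \<Rightarrow> 's monomial \<Rightarrow> 's polynomial"
  where "subst_mono x \<phi> M =
    (let D = {E \<in> M. 0 < E x}
     in if D = {} then {M}
        else if \<phi> = {} then {}
        else {(M - D) \<union> (\<Union>E\<in>D. (\<lambda>F. subst_comb x F E) ` N E) | N. N \<in> D \<rightarrow>\<^sub>E \<phi>})"

definition subst_poly :: "'s \<Rightarrow> 's polynomial \<Rightarrow> 's polynomial \<Rightarrow> 's polynomial"
  where "subst_poly x \<phi> \<psi> = (\<Union>M\<in>\<psi>. subst_mono x \<phi> M)"


section \<open>The elimination algorithm\<close>

definition eliminate :: "'s \<Rightarrow> 's system \<Rightarrow> 's system"
  where "eliminate x I =
    (let \<phi>' = cancel x (rearrange x (I x))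
     in (\<lambda>y. if y = x then \<phi>' else subst_poly x \<phi>' (I y)))"

text \<open>\<open>stage X I j\<close> is the system obtained from \<open>I\<close> after eliminating \<open>X 1, \<dots>, X j\<close> in turn.\<close>

primrec stage :: "(nat \<Rightarrow> 's) \<Rightarrow> 's system \<Rightarrow> nat \<Rightarrow> 's system"
  where
    "stage X I 0 = I"
  | "stage X I (Suc j) = eliminate (X (Suc j)) (stage X I j)"

end

theory Submission
  imports Defs
begin

text \<open>
  Replacing the values of the parameters by their convex hulls changes neither the smallest
  solution nor the hull of any evaluation. For convex values, evaluation is linear in the
  coefficients and idempotent for joins, so the formal operations can be tracked exactly.
  Eliminating \<open>x\<close> keeps every solution. Conversely, a solution \<open>A\<close> of the new system dominates a
  solution of the old one, obtained by lowering \<open>A x\<close> to the hull of the value of the cancelled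
  polynomial. Hence the smallest solution is the same at all stages, and after the last one it
  can be read off.
\<close>


section \<open>Joins of convex sets\<close>

text \<open>For arbitrary sets \<open>E \<star> E\<close> may differ from \<open>E\<close>, and
  \<open>(c + d) A\<close> from \<open>c A + d A\<close>, so merging equal factors or collecting
  coefficients could change a value. Hulls repair this at no cost: they commute with joins,
  Minkowski sums and dilations, and the outer hull that a union requires is invisible to an
  inclusion into a convex set. In the inequality for \<open>x\<close>, a factor
  \<open>rho x + (1 - rho) E\<close> contracts the value of \<open>x\<close> toward points of
  \<open>E\<close>. Iterating the contraction shows that a convex solution absorbs joins with the
  cofactor; no closure is taken, because joins consist of open segments. Cancellation may stop at
  products of a free monomial with a single cofactor, because idempotence gives \<open>M' \<star> M
  \<star> N = (M' \<star> M) \<star> (M' \<star> N)\<close>. Cancellation can enlarge the set of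
  solutions: the new inequality no longer forces \<open>A x\<close> to absorb the cofactors. Systems
  are therefore compared only up to lowering a solution, which is enough for the smallest
  one.\<close>

lemma gjoinI: "0 < l \<Longrightarrow> l < 1 \<Longrightarrow> a \<in> A \<Longrightarrow> b \<in> B \<Longrightarrow> l *\<^sub>R a + (1 - l) *\<^sub>R b \<in> A \<star> B"
  unfolding gjoin_def by blast

lemma gjoinE:
  assumes "x \<in> A \<star> B"
  obtains l a b where "0 < l" "l < 1" "a \<in> A" "b \<in> B" "x = l *\<^sub>R a + (1 - l) *\<^sub>R b"
  using assms unfolding gjoin_def by blast

lemma gjoin_mono: "A \<subseteq> A' \<Longrightarrow> B \<subseteq> B' \<Longrightarrow> A \<star> B \<subseteq> A' \<star> B'"
  unfolding gjoin_def by blast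

lemma gjoin_UN_left: "(\<Union>i\<in>I. A i) \<star> B = (\<Union>i\<in>I. A i \<star> B)"
  unfolding gjoin_def by blast

lemma gjoin_UN_UN: "(\<Union>i\<in>I. A i) \<star> (\<Union>j\<in>J. B j) = (\<Union>i\<in>I. \<Union>j\<in>J. A i \<star> B j)"
  unfolding gjoin_def by blast

lemma gjoin_Un_left: "(A \<union> A') \<star> B = (A \<star> B) \<union> (A' \<star> B)"
  unfolding gjoin_def by blast

lemma gjoin_subset_convex: "convex C \<Longrightarrow> A \<subseteq> C \<Longrightarrow> B \<subseteq> C \<Longrightarrow> A \<star> B \<subseteq> C"
  by (auto elim!: gjoinE intro!: convexD)

lemma gjoin_idem:
  assumes "convex C"
  shows "C \<star> C = C"
proof
  show "C \<star> C \<subseteq> C"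
    using assms by (simp add: gjoin_subset_convex)
  show "C \<subseteq> C \<star> C"
  proof
    fix x assume "x \<in> C"
    then have "(1/2) *\<^sub>R x + (1 - 1/2) *\<^sub>R x \<in> C \<star> C"
      by (intro gjoinI) auto
    moreover have "(1/2) *\<^sub>R x + (1 - 1/2) *\<^sub>R x = x"
      by (simp flip: scaleR_add_left)
    ultimately show "x \<in> C \<star> C" by simp
  qed
qed

text \<open>Follows from \<open>A = A \<star> A\<close>. It breaks a triple join into two pairs that
  both contain \<open>A\<close>, so one round of cancellation already yields a set closed under
  joins with all cofactors.\<close>

lemma gjoin_distrib_convex:
  assumes "convex A"
  shows "(A \<star> B) \<star> C = (A \<star> B) \<star> (A \<star> C)"
proof -
  have "(A \<star> B) \<star> (A \<star> C) = (A \<star> A) \<star> (B \<star> C)"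
    by (simp only: gjoin_assoc gjoin_left_commute[of B A])
  then show ?thesis
    by (simp only: gjoin_idem[OF assms] gjoin_assoc)
qed

lemma convex_gjoin:
  assumes "convex A" "convex B"
  shows "convex (A \<star> B)"
  unfolding convex_alt
proof (intro ballI allI impI, elim conjE)
  fix x y and u :: real
  assume x: "x \<in> A \<star> B" and y: "y \<in> A \<star> B" and u: "0 \<le> u" "u \<le> 1"
  show "(1 - u) *\<^sub>R x + u *\<^sub>R y \<in> A \<star> B"
  proof (cases "u = 0 \<or> u = 1")
    case True
    then show ?thesis using x y by auto
  next
    case False
    then have u: "0 < u" "u < 1" using u by auto
    obtain l a b where l: "0 < l" "l < 1" "a \<in> A" "b \<in> B" "x = l *\<^sub>R a + (1 - l) *\<^sub>R b"
      using x by (rule gjoinE)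
    obtain m c d where m: "0 < m" "m < 1" "c \<in> A" "d \<in> B" "y = m *\<^sub>R c + (1 - m) *\<^sub>R d"
      using y by (rule gjoinE)
    \<comment> \<open>\<open>k\<close> is the total weight on points of \<open>A\<close>. Below,
      \<open>p\<close> and \<open>q\<close> are the weighted means of the two points from
      \<open>A\<close> and of the two points from \<open>B\<close>.\<close>
    define k where "k = (1 - u) * l + u * m"
    have pos: "0 < (1 - u) * l" "0 < u * m" "0 < (1 - u) * (1 - l)" "0 < u * (1 - m)"
      using u l m by auto
    have k1: "1 - k = (1 - u) * (1 - l) + u * (1 - m)"
      by (simp add: k_def algebra_simps)
    have k: "0 < k" "k < 1"
      using pos k1 unfolding k_def by linarith+
    define p where "p = ((1 - u) * l / k) *\<^sub>R a + (u * m / k) *\<^sub>R c"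
    define q where "q = ((1 - u) * (1 - l) / (1 - k)) *\<^sub>R b + (u * (1 - m) / (1 - k)) *\<^sub>R d"
    have "(1 - u) * l / k + u * m / k = 1"
      using k by (simp add: k_def flip: add_divide_distrib)
    then have p: "p \<in> A"
      unfolding p_def using assms l m k pos by (intro convexD) auto
    have "(1 - u) * (1 - l) / (1 - k) + u * (1 - m) / (1 - k) = 1"
      using k k1 by (simp flip: add_divide_distrib)
    then have q: "q \<in> B"
      unfolding q_def using assms l m k pos by (intro convexD) auto
    have "k *\<^sub>R p = ((1 - u) * l) *\<^sub>R a + (u * m) *\<^sub>R c"
      using k by (simp add: p_def scaleR_add_right)
    moreover have "(1 - k) *\<^sub>R q = ((1 - u) * (1 - l)) *\<^sub>R b + (u * (1 - m)) *\<^sub>R d"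
      using k by (simp add: q_def scaleR_add_right)
    ultimately have "(1 - u) *\<^sub>R x + u *\<^sub>R y = k *\<^sub>R p + (1 - k) *\<^sub>R q"
      by (simp add: l m scaleR_add_right)
    then show ?thesis using gjoinI[OF k p q] by simp
  qed
qed

lemma scaleR_gjoin:
  fixes A B :: "'a::real_vector set"
  shows "(*\<^sub>R) c ` (A \<star> B) = ((*\<^sub>R) c ` A) \<star> ((*\<^sub>R) c ` B)"
proof -
  have eq: "c *\<^sub>R (l *\<^sub>R a + (1 - l) *\<^sub>R b) = l *\<^sub>R (c *\<^sub>R a) + (1 - l) *\<^sub>R (c *\<^sub>R b)" for l and a b :: 'a
    by (simp add: scaleR_add_right mult.commute[of c])
  show ?thesis
  proof (intro equalityI subsetI)
    fix x assume "x \<in> (*\<^sub>R) c ` (A \<star> B)"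
    then show "x \<in> ((*\<^sub>R) c ` A) \<star> ((*\<^sub>R) c ` B)"
      by (auto elim!: gjoinE simp only: eq intro!: gjoinI)
  next
    fix x assume "x \<in> ((*\<^sub>R) c ` A) \<star> ((*\<^sub>R) c ` B)"
    then show "x \<in> (*\<^sub>R) c ` (A \<star> B)"
      by (auto elim!: gjoinE intro!: gjoinI simp flip: eq simp del: scaleR_scaleR)
  qed
qed

text \<open>Convexity enters from right to left: the two points of \<open>C\<close> added to the two
  ends are averaged into a single one.\<close>

lemma gjoin_plus_convex:
  assumes "convex C"
  shows "(A \<star> B) + C = (A + C) \<star> (B + C)"
proof
  show "(A \<star> B) + C \<subseteq> (A + C) \<star> (B + C)"
  proof
    fix x assume "x \<in> (A \<star> B) + C"
    then obtain l a b c where "0 < l" "l < 1" "a \<in> A" "b \<in> B" "c \<in> C"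
      and x: "x = l *\<^sub>R a + (1 - l) *\<^sub>R b + c"
      by (auto elim!: set_plus_elim gjoinE)
    then have "l *\<^sub>R (a + c) + (1 - l) *\<^sub>R (b + c) \<in> (A + C) \<star> (B + C)"
      by (intro gjoinI) auto
    moreover have "l *\<^sub>R (a + c) + (1 - l) *\<^sub>R (b + c) = x"
      by (simp add: x algebra_simps)
    ultimately show "x \<in> (A + C) \<star> (B + C)" by simp
  qed
  show "(A + C) \<star> (B + C) \<subseteq> (A \<star> B) + C"
  proof
    fix x assume "x \<in> (A + C) \<star> (B + C)"
    then obtain l a b c d where l: "0 < l" "l < 1" "a \<in> A" "b \<in> B" "c \<in> C" "d \<in> C"
      and x: "x = l *\<^sub>R (a + c) + (1 - l) *\<^sub>R (b + d)"
      by (auto elim!: set_plus_elim gjoinE)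
    have "(l *\<^sub>R a + (1 - l) *\<^sub>R b) + (l *\<^sub>R c + (1 - l) *\<^sub>R d) \<in> (A \<star> B) + C"
      using l assms by (intro set_plus_intro gjoinI convexD) auto
    then show "x \<in> (A \<star> B) + C"
      by (simp add: x algebra_simps)
  qed
qed

text \<open>A join is a union of Minkowski combinations \<open>l A + (1 - l) B\<close>, and the hull
  commutes with each of these. Conversely, the join of the hulls is already convex.\<close>

lemma hull_gjoin: "convex hull (A \<star> B) = (convex hull A) \<star> (convex hull B)"
proof
  show "convex hull (A \<star> B) \<subseteq> (convex hull A) \<star> (convex hull B)"
    by (intro hull_minimal gjoin_mono hull_subset convex_gjoin convex_convex_hull)
  show "(convex hull A) \<star> (convex hull B) \<subseteq> convex hull (A \<star> B)"
  proof
    fix x assume "x \<in> (convex hull A) \<star> (convex hull B)"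
    then obtain l a b where l: "0 < l" "l < 1" "a \<in> convex hull A" "b \<in> convex hull B"
      and x: "x = l *\<^sub>R a + (1 - l) *\<^sub>R b"
      by (rule gjoinE)
    have "x \<in> (*\<^sub>R) l ` (convex hull A) + (*\<^sub>R) (1 - l) ` (convex hull B)"
      using l x by auto
    then have "x \<in> convex hull ((*\<^sub>R) l ` A + (*\<^sub>R) (1 - l) ` B)"
      by (simp add: convex_hull_set_plus convex_hull_scaling)
    moreover have "(*\<^sub>R) l ` A + (*\<^sub>R) (1 - l) ` B \<subseteq> A \<star> B"
      using l by (auto elim!: set_plus_elim intro: gjoinI)
    ultimately show "x \<in> convex hull (A \<star> B)"
      using hull_mono by blast
  qed
qed

text \<open>Unions are the one operation of evaluation that destroys convexity, hence the outer hull
  on both sides.\<close>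

lemma hull_UN_hull: "convex hull (\<Union>i\<in>I. convex hull A i) = convex hull (\<Union>i\<in>I. A i)"
proof
  have "convex hull A i \<subseteq> convex hull (\<Union>i\<in>I. A i)" if "i \<in> I" for i
    using that by (intro hull_mono) blast
  then show "convex hull (\<Union>i\<in>I. convex hull A i) \<subseteq> convex hull (\<Union>i\<in>I. A i)"
    by (intro hull_minimal convex_convex_hull) blast
  show "convex hull (\<Union>i\<in>I. A i) \<subseteq> convex hull (\<Union>i\<in>I. convex hull A i)"
    by (intro hull_mono UN_mono hull_subset order_refl)
qed


section \<open>Iterated joins\<close>

lemma big_gjoin_cong: "(\<And>e. e \<in> S \<Longrightarrow> f e = g e) \<Longrightarrow> finite S \<Longrightarrow> S \<noteq> {} \<Longrightarrow> big_gjoin f S = big_gjoin g S"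
  by (intro equalityI big_gjoin_mono) auto

lemma convex_big_gjoin:
  assumes "finite S" "S \<noteq> {}" "\<And>e. e \<in> S \<Longrightarrow> convex (f e)"
  shows "convex (big_gjoin f S)"
  using assms
  by (induction S rule: finite_ne_induct) (auto simp: big_gjoin_singleton big_gjoin_insert convex_gjoin)

lemma hull_big_gjoin:
  assumes "finite S" "S \<noteq> {}"
  shows "convex hull (big_gjoin f S) = big_gjoin (\<lambda>e. convex hull (f e)) S"
  using assms
  by (induction S rule: finite_ne_induct) (auto simp: big_gjoin_singleton big_gjoin_insert hull_gjoin)

lemma big_gjoin_Un_disjoint:
  assumes "finite S" "S \<noteq> {}" "finite T" "T \<noteq> {}" "S \<inter> T = {}"
  shows "big_gjoin f (S \<union> T) = big_gjoin f S \<star> big_gjoin f T"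
  using assms
  by (induction S rule: finite_ne_induct) (auto simp: big_gjoin_singleton big_gjoin_insert gjoin_assoc)

text \<open>For convex factors the idempotence \<open>E \<star> E = E\<close> of the syntax holds semantically as well,
  so from here on no distinctness is required.\<close>

lemma big_gjoin_insert_convex:
  assumes "finite S" "S \<noteq> {}" "convex (f e)"
  shows "big_gjoin f (insert e S) = f e \<star> big_gjoin f S"
proof (cases "e \<in> S")
  case False
  then show ?thesis using assms by (simp add: big_gjoin_insert)
next
  case e: True
  show ?thesis
  proof (cases "S - {e} = {}")
    case True
    then have "S = {e}" using e by blast
    then show ?thesis using assms by (simp add: big_gjoin_singleton gjoin_idem)
  next
    case False
    then have "big_gjoin f (insert e (S - {e})) = f e \<star> big_gjoin f (S - {e})"
      using assms by (intro big_gjoin_insert) auto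
    moreover have "insert e (S - {e}) = S" using e by blast
    ultimately show ?thesis
      using assms e by (simp add: insert_absorb gjoin_idem flip: gjoin_assoc)
  qed
qed

lemma big_gjoin_Un_convex:
  assumes "finite S" "S \<noteq> {}" "finite T" "T \<noteq> {}" "\<And>e. e \<in> S \<Longrightarrow> convex (f e)"
  shows "big_gjoin f (S \<union> T) = big_gjoin f S \<star> big_gjoin f T"
  using assms
  by (induction S rule: finite_ne_induct)
    (auto simp: big_gjoin_singleton big_gjoin_insert big_gjoin_insert_convex gjoin_assoc)

lemma big_gjoin_UN_convex:
  assumes "finite S" "S \<noteq> {}" "\<And>s. s \<in> S \<Longrightarrow> finite (T s)" "\<And>s. s \<in> S \<Longrightarrow> T s \<noteq> {}"
    "\<And>s e. s \<in> S \<Longrightarrow> e \<in> T s \<Longrightarrow> convex (f e)"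
  shows "big_gjoin f (\<Union>s\<in>S. T s) = big_gjoin (\<lambda>s. big_gjoin f (T s)) S"
  using assms
proof (induction S rule: finite_ne_induct)
  case (singleton s)
  then show ?case by (simp add: big_gjoin_singleton)
next
  case (insert s S)
  have "big_gjoin f (T s \<union> (\<Union>s\<in>S. T s)) = big_gjoin f (T s) \<star> big_gjoin f (\<Union>s\<in>S. T s)"
    using insert.hyps insert.prems by (intro big_gjoin_Un_convex) auto
  moreover have "big_gjoin f (\<Union>s\<in>S. T s) = big_gjoin (\<lambda>s. big_gjoin f (T s)) S"
    using insert.prems by (intro insert.IH) auto
  ultimately show ?case
    using insert.hyps by (simp add: big_gjoin_insert)
qed

lemma big_gjoin_image_convex:
  assumes "finite S" "S \<noteq> {}" "\<And>s. s \<in> S \<Longrightarrow> convex (f (g s))"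
  shows "big_gjoin f (g ` S) = big_gjoin (\<lambda>s. f (g s)) S"
  using big_gjoin_UN_convex[of S "\<lambda>s. {g s}" f] assms
  by (simp add: big_gjoin_singleton UNION_singleton_eq_range)

text \<open>Distributing a join over unions gives one term per choice function; this is where the
  index set of \<open>subst_mono\<close> comes from.\<close>

lemma big_gjoin_UN_PiE:
  fixes g :: "'c \<Rightarrow> 'b \<Rightarrow> 'a::real_vector set"
  assumes "finite S" "S \<noteq> {}"
  shows "big_gjoin (\<lambda>s. \<Union>k\<in>K. g k s) S = (\<Union>h\<in>S \<rightarrow>\<^sub>E K. big_gjoin (\<lambda>s. g (h s) s) S)"
  using assms
proof (induction S rule: finite_ne_induct)
  case (singleton s)
  have "{s} \<rightarrow>\<^sub>E K = (\<lambda>k. (\<lambda>_. undefined)(s := k)) ` K"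
    by (auto simp: PiE_insert_eq image_iff)
  then show ?case by (simp add: big_gjoin_singleton)
next
  case (insert s S)
  have "big_gjoin (\<lambda>t. g ((h(s := k)) t) t) (insert s S) = g k s \<star> big_gjoin (\<lambda>t. g (h t) t) S"
    for h k
  proof -
    have "big_gjoin (\<lambda>t. g ((h(s := k)) t) t) S = big_gjoin (\<lambda>t. g (h t) t) S"
      using insert.hyps by (intro big_gjoin_cong) auto
    then show ?thesis
      using insert.hyps by (simp add: big_gjoin_insert)
  qed
  moreover have "(\<Union>h\<in>insert s S \<rightarrow>\<^sub>E K. G h) = (\<Union>k\<in>K. \<Union>h\<in>S \<rightarrow>\<^sub>E K. G (h(s := k)))"
    for G :: "('b \<Rightarrow> 'c) \<Rightarrow> 'a set"
    by (auto simp: PiE_insert_eq) blast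
  ultimately show ?case
    using insert.hyps by (simp add: big_gjoin_insert insert.IH gjoin_UN_UN)
qed


section \<open>Evaluation as a linear operation\<close>

text \<open>The convention \<open>0 \<cdot> \<emptyset> = {0}\<close> is the one under which evaluation is linear in the
  coefficients.\<close>

definition dilate :: "real \<Rightarrow> 'a::real_vector set \<Rightarrow> 'a set"
  where "dilate c A = (if 0 < c then (*\<^sub>R) c ` A else 0)"

lemma dilate_0 [simp]: "dilate 0 A = 0"
  and dilate_1 [simp]: "dilate 1 A = A"
  by (simp_all add: dilate_def)

lemma convex_dilate: "convex A \<Longrightarrow> convex (dilate c A)"
  by (simp add: dilate_def convex_scaling)

lemma dilate_hull: "dilate c (convex hull A) = convex hull (dilate c A)"
  by (simp add: dilate_def convex_hull_scaling set_zero)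

lemma dilate_dilate: "0 \<le> c \<Longrightarrow> 0 \<le> d \<Longrightarrow> dilate c (dilate d A) = dilate (c * d) A"
  by (auto simp: dilate_def image_image zero_less_mult_iff set_zero)

lemma dilate_plus: "dilate c (A + B) = dilate c A + dilate c B"
proof -
  have "(*\<^sub>R) c ` (A + B) = (*\<^sub>R) c ` A + (*\<^sub>R) c ` B"
  proof (intro equalityI subsetI)
    fix x assume "x \<in> (*\<^sub>R) c ` (A + B)"
    then show "x \<in> (*\<^sub>R) c ` A + (*\<^sub>R) c ` B"
      by (auto elim!: set_plus_elim simp: scaleR_add_right intro!: set_plus_intro)
  next
    fix x assume "x \<in> (*\<^sub>R) c ` A + (*\<^sub>R) c ` B"
    then show "x \<in> (*\<^sub>R) c ` (A + B)"
      by (auto elim!: set_plus_elim simp flip: scaleR_add_right)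
  qed
  then show ?thesis by (simp add: dilate_def)
qed

lemma dilate_zero: "dilate c 0 = 0"
  by (simp add: dilate_def set_zero)

lemma dilate_sum: "dilate c (sum f S) = (\<Sum>s\<in>S. dilate c (f s))"
  by (induction S rule: infinite_finite_induct) (simp_all only: sum.infinite sum.empty sum.insert dilate_plus dilate_zero not_False_eq_True)

text \<open>By convexity, \<open>c a + d b\<close> is \<open>c + d\<close> times a weighted mean of
  \<open>a\<close> and \<open>b\<close>. If a coefficient vanishes, its summand is the neutral set,
  even when \<open>A\<close> is empty.\<close>

lemma dilate_add:
  assumes "convex A" "0 \<le> c" "0 \<le> d"
  shows "dilate (c + d) A = dilate c A + dilate d A"
proof (cases "0 < c \<and> 0 < d")
  case True
  have "(*\<^sub>R) (c + d) ` A = (*\<^sub>R) c ` A + (*\<^sub>R) d ` A"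
  proof
    show "(*\<^sub>R) (c + d) ` A \<subseteq> (*\<^sub>R) c ` A + (*\<^sub>R) d ` A"
      by (auto simp: scaleR_add_left)
    show "(*\<^sub>R) c ` A + (*\<^sub>R) d ` A \<subseteq> (*\<^sub>R) (c + d) ` A"
    proof
      fix x assume "x \<in> (*\<^sub>R) c ` A + (*\<^sub>R) d ` A"
      then obtain a b where ab: "a \<in> A" "b \<in> A" and x: "x = c *\<^sub>R a + d *\<^sub>R b"
        by (auto elim!: set_plus_elim)
      have "c / (c + d) + d / (c + d) = 1"
        using True by (simp flip: add_divide_distrib)
      then have "(c / (c + d)) *\<^sub>R a + (d / (c + d)) *\<^sub>R b \<in> A"
        using True assms ab by (intro convexD) auto
      moreover have "x = (c + d) *\<^sub>R ((c / (c + d)) *\<^sub>R a + (d / (c + d)) *\<^sub>R b)"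
        using True by (simp add: x scaleR_add_right)
      ultimately show "x \<in> (*\<^sub>R) (c + d) ` A" by blast
    qed
  qed
  then show ?thesis using True by (simp add: dilate_def)
next
  case False
  then have "c = 0 \<or> d = 0" using assms by auto
  then show ?thesis by auto
qed

text \<open>For \<open>c = 0\<close> and empty \<open>I\<close> the left side would be the set
  containing only the origin, and the right side empty. The zero polynomial may thus only be
  substituted where \<open>x\<close> really occurs.\<close>

lemma dilate_UN: "0 < c \<Longrightarrow> dilate c (\<Union>i\<in>I. A i) = (\<Union>i\<in>I. dilate c (A i))"
  by (auto simp: dilate_def)

lemma UN_plus: "(\<Union>i\<in>I. A i) + B = (\<Union>i\<in>I. A i + B)"
  by (auto elim!: set_plus_elim)

text \<open>The semantic reason why a monomial can be substituted into a linear combination factor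
  by factor; \<open>C\<close> stands for the part of the combination that is free of
  \<open>x\<close>.\<close>

lemma dilate_big_gjoin_plus:
  assumes "finite S" "S \<noteq> {}" "0 < c" "convex C"
  shows "dilate c (big_gjoin f S) + C = big_gjoin (\<lambda>e. dilate c (f e) + C) S"
  using assms
  by (induction S rule: finite_ne_induct)
    (auto simp: big_gjoin_singleton big_gjoin_insert dilate_def scaleR_gjoin gjoin_plus_convex)

text \<open>Variables and parameters play the same role in an evaluation, so all symbols are merged into
  a single assignment \<open>A\<close>.\<close>

abbreviation comb_val :: "('s \<Rightarrow> 'a::real_vector set) \<Rightarrow> 's lincomb \<Rightarrow> 'a set"
  where "comb_val A \<equiv> eval_comb UNIV {} A (\<lambda>_. {})"

abbreviation mono_val :: "('s \<Rightarrow> 'a::real_vector set) \<Rightarrow> 's monomial \<Rightarrow> 'a set"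
  where "mono_val A \<equiv> eval_mono UNIV {} A (\<lambda>_. {})"

abbreviation poly_val :: "('s \<Rightarrow> 'a::real_vector set) \<Rightarrow> 's polynomial \<Rightarrow> 'a set"
  where "poly_val A \<equiv> eval_poly UNIV {} A (\<lambda>_. {})"

text \<open>The index set no longer depends on \<open>E\<close>, so combinations with different
  supports can be added term by term.\<close>

lemma comb_val_eq_sum_dilate:
  assumes "finite S" "\<And>\<omega>. \<omega> \<notin> S \<Longrightarrow> E \<omega> = 0"
  shows "comb_val A E = (\<Sum>\<omega>\<in>S. dilate (E \<omega>) (A \<omega>))"
proof -
  have "(\<Sum>\<omega>\<in>S. dilate (E \<omega>) (A \<omega>)) = (\<Sum>\<omega>\<in>{\<omega>. 0 < E \<omega>}. (*\<^sub>R) (E \<omega>) ` A \<omega>)"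
    using assms by (intro sum.mono_neutral_cong_right) (force simp: dilate_def)+
  then show ?thesis by (simp add: eval_comb_def)
qed

lemma comb_val_cong: "(\<And>\<omega>. 0 < E \<omega> \<Longrightarrow> A \<omega> = B \<omega>) \<Longrightarrow> comb_val A E = comb_val B E"
  by (simp add: eval_comb_def)

lemma convex_comb_val: "(\<And>\<omega>. convex (A \<omega>)) \<Longrightarrow> convex (comb_val A E)"
  unfolding eval_comb_def by (intro convex_set_plus convex_set_sum convex_scaling) (auto simp: set_zero)

lemma comb_val_hull: "comb_val (\<lambda>\<omega>. convex hull (A \<omega>)) E = convex hull (comb_val A E)"
  by (simp add: eval_comb_def convex_hull_set_plus convex_hull_set_sum convex_hull_scaling)

text \<open>Stated for nonnegative functions of finite support instead of elements of
  \<open>CL\<close>, because \<open>residual x E\<close> is the zero function when \<open>E\<close>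
  is \<open>x\<close> itself.\<close>

lemma comb_val_linear:
  assumes "\<And>\<omega>. convex (A \<omega>)" "0 \<le> a" "0 \<le> b" "\<And>\<omega>. 0 \<le> E \<omega>" "\<And>\<omega>. 0 \<le> F \<omega>"
    "finite S" "\<And>\<omega>. \<omega> \<notin> S \<Longrightarrow> E \<omega> = 0" "\<And>\<omega>. \<omega> \<notin> S \<Longrightarrow> F \<omega> = 0"
  shows "comb_val A (\<lambda>\<omega>. a * E \<omega> + b * F \<omega>) = dilate a (comb_val A E) + dilate b (comb_val A F)"
  using assms
  by (simp add: comb_val_eq_sum_dilate[of S] dilate_sum dilate_dilate dilate_add
      flip: sum.distrib)

lemma comb_val_unit: "comb_val A (unit_comb x) = A x"
  by (subst comb_val_eq_sum_dilate[of "{x}"]) (auto simp: unit_comb_def)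

section \<open>Splitting off the coefficient of one symbol\<close>

lemma CL_merge: "CL \<Omega>v \<Omega>p = CL (\<Omega>v \<union> \<Omega>p) {}"
  by (simp add: CL_def)

lemma CL_nonneg: "E \<in> CL \<Omega> {} \<Longrightarrow> 0 \<le> E \<omega>"
  and CL_outside: "E \<in> CL \<Omega> {} \<Longrightarrow> \<omega> \<notin> \<Omega> \<Longrightarrow> E \<omega> = 0"
  and CL_sum: "E \<in> CL \<Omega> {} \<Longrightarrow> sum E \<Omega> = 1"
  by (simp_all add: CL_def)

lemma CL_le_1:
  assumes "E \<in> CL \<Omega> {}" "finite \<Omega>"
  shows "E x \<le> 1"
proof (cases "x \<in> \<Omega>")
  case True
  then have "E x \<le> sum E \<Omega>"
    using assms by (intro member_le_sum) (auto simp: CL_nonneg)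
  then show ?thesis using assms by (simp add: CL_sum)
qed (use assms in \<open>simp add: CL_outside\<close>)

lemma CL_eq_unit:
  assumes "E \<in> CL \<Omega> {}" "finite \<Omega>" "E x = 1"
  shows "E = unit_comb x"
proof
  fix \<omega>
  have x: "x \<in> \<Omega>"
    using assms CL_outside by fastforce
  have "sum E (\<Omega> - {x}) = 0"
    using assms x by (simp add: sum_diff1 CL_sum)
  then have "\<forall>\<omega>\<in>\<Omega> - {x}. E \<omega> = 0"
    using assms by (subst (asm) sum_nonneg_eq_0_iff) (auto simp: CL_nonneg)
  then show "E \<omega> = unit_comb x \<omega>"
    using assms by (cases "\<omega> \<in> \<Omega>") (auto simp: unit_comb_def CL_outside)
qed

lemma residual_nonneg: "E \<in> CL \<Omega> {} \<Longrightarrow> finite \<Omega> \<Longrightarrow> 0 \<le> residual x E \<omega>"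
  by (simp add: residual_def CL_nonneg CL_le_1)

lemma residual_outside: "E \<in> CL \<Omega> {} \<Longrightarrow> \<omega> \<notin> \<Omega> - {x} \<Longrightarrow> residual x E \<omega> = 0"
  by (auto simp: residual_def CL_outside)

lemma CL_decompose:
  assumes "E \<in> CL \<Omega> {}" "finite \<Omega>"
  shows "E = (\<lambda>\<omega>. E x * unit_comb x \<omega> + (1 - E x) * residual x E \<omega>)"
proof (cases "E x = 1")
  case True
  then show ?thesis using CL_eq_unit[OF assms] by (simp add: unit_comb_def)
next
  case False
  then show ?thesis by (auto simp: fun_eq_iff unit_comb_def residual_def)
qed

lemma comb_val_subst:
  assumes "E \<in> CL \<Omega> {}" "F \<in> CL \<Omega> {}" "finite \<Omega>" "\<And>\<omega>. convex (A \<omega>)"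
  shows "comb_val A (subst_comb x F E) =
    dilate (E x) (comb_val A F) + dilate (1 - E x) (comb_val A (residual x E))"
  unfolding subst_comb_def using assms
  by (intro comb_val_linear[of A _ _ _ _ \<Omega>])
    (auto simp: CL_nonneg CL_le_1 residual_nonneg CL_outside residual_outside)

lemma comb_val_decompose:
  assumes "E \<in> CL \<Omega> {}" "finite \<Omega>" "\<And>\<omega>. convex (A \<omega>)"
  shows "comb_val A E = dilate (E x) (A x) + dilate (1 - E x) (comb_val A (residual x E))"
proof -
  have "comb_val A (\<lambda>\<omega>. E x * unit_comb x \<omega> + (1 - E x) * residual x E \<omega>) =
    dilate (E x) (comb_val A (unit_comb x)) + dilate (1 - E x) (comb_val A (residual x E))"
    using assms
    \<comment> \<open>The support of \<open>unit_comb x\<close> has to be covered too, and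
      \<open>x\<close> is not assumed to lie in \<open>\<Omega>\<close>.\<close>
    by (intro comb_val_linear[of A _ _ _ _ "insert x \<Omega>"])
      (auto simp: CL_nonneg CL_le_1 residual_nonneg unit_comb_def residual_outside)
  then show ?thesis
    using CL_decompose[OF assms(1,2), of x] by (simp add: comb_val_unit)
qed

lemma comb_val_residual_upd: "comb_val (A(x := C)) (residual x E) = comb_val A (residual x E)"
  by (rule comb_val_cong) (auto simp: residual_def)

lemma comb_val_upd: "\<not> 0 < E x \<Longrightarrow> comb_val (A(x := C)) E = comb_val A E"
  by (rule comb_val_cong) auto

lemma mono_val_singleton: "mono_val A {E} = comb_val A E"
  by (simp add: eval_mono_def big_gjoin_singleton)

lemma mono_val_cong:
  "M \<in> monomials \<Omega> {} \<Longrightarrow> (\<And>E. E \<in> M \<Longrightarrow> comb_val A E = comb_val B E) \<Longrightarrow> mono_val A M = mono_val B M"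
  unfolding eval_mono_def by (intro big_gjoin_cong) (auto simp: monomials_def)

lemma convex_mono_val:
  "finite M \<Longrightarrow> M \<noteq> {} \<Longrightarrow> (\<And>\<omega>. convex (A \<omega>)) \<Longrightarrow> convex (mono_val A M)"
  unfolding eval_mono_def by (intro convex_big_gjoin convex_comb_val) auto

lemma mono_val_Un:
  assumes "finite M" "M \<noteq> {}" "finite N" "N \<noteq> {}" "\<And>\<omega>. convex (A \<omega>)"
  shows "mono_val A (M \<union> N) = mono_val A M \<star> mono_val A N"
  unfolding eval_mono_def using assms by (intro big_gjoin_Un_convex convex_comb_val)

lemma poly_val_mono:
  assumes "\<phi> \<in> polynomials \<Omega> {}" "\<And>\<omega>. A \<omega> \<subseteq> B \<omega>"
  shows "poly_val A \<phi> \<subseteq> poly_val B \<phi>"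
  unfolding eval_poly_def eval_mono_def using assms
  by (intro UN_mono big_gjoin_mono eval_comb_mono) (auto simp: polynomials_def monomials_def)


section \<open>Rearrangement and cancellation\<close>

lemma cofactor_insert: "cofactor x (insert E N) = cofactor x {E} \<union> cofactor x N"
  by (auto simp: cofactor_def)

lemma cofactor_singleton:
  "cofactor x {E} = (if 0 < E x then if E x < 1 then {residual x E} else {} else {E})"
  by (auto simp: cofactor_def)

lemma cofactor_free: "F \<in> cofactor x N \<Longrightarrow> \<not> 0 < F x"
  by (auto simp: cofactor_def residual_def)

lemma finite_cofactor: "finite N \<Longrightarrow> finite (cofactor x N)"
  by (simp add: cofactor_def)

lemma unit_notin_cofactor: "unit_comb x \<notin> cofactor x N"
  using cofactor_free[of "unit_comb x" x N] by (auto simp: unit_comb_def)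

text \<open>A factor leaves no trace in the cofactor only if it equals \<open>x\<close>, and factors
  are distinct. So the single case of an empty product is the monomial that rearrangement
  drops.\<close>

lemma cofactor_nonempty:
  assumes "N \<in> monomials \<Omega> {}" "finite \<Omega>" "N \<noteq> {unit_comb x}"
  shows "cofactor x N \<noteq> {}"
proof
  assume "cofactor x N = {}"
  then have *: "0 < E x \<and> \<not> E x < 1" if "E \<in> N" for E
    using that by (auto simp: cofactor_def)
  have "E = unit_comb x" if "E \<in> N" for E
  proof (rule CL_eq_unit)
    show "E \<in> CL \<Omega> {}" using that assms by (auto simp: monomials_def)
    then show "E x = 1" using *[OF that] CL_le_1[of E \<Omega> x] assms by simp
  qed fact
  then show False using assms by (auto simp: monomials_def)
qed

text \<open>In use, \<open>C\<close> is the value of \<open>x\<close>, \<open>M\<close> that of a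
  cofactor and \<open>G\<close> that of the monomial. The ratio \<open>t\<close> may vary with
  \<open>m\<close> but is uniform in \<open>c\<close>: if \<open>G\<close> lies in \<open>C\<close>,
  one and the same contraction can be iterated, and \<open>t < 1\<close> makes the iterates approach
  \<open>m\<close>.\<close>

definition pulls :: "'a::real_vector set \<Rightarrow> 'a set \<Rightarrow> 'a set \<Rightarrow> bool"
  where "pulls C M G \<longleftrightarrow> (\<forall>m\<in>M. \<exists>t. 0 \<le> t \<and> t < 1 \<and> (\<forall>c\<in>C. t *\<^sub>R c + (1 - t) *\<^sub>R m \<in> G))"

lemma pullsD:
  assumes "pulls C M G" "m \<in> M"
  obtains t where "0 \<le> t" "t < 1" "\<And>c. c \<in> C \<Longrightarrow> t *\<^sub>R c + (1 - t) *\<^sub>R m \<in> G"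
  using assms unfolding pulls_def by blast

text \<open>Treats a factor equal to \<open>x\<close>, which contributes nothing to the cofactor.
  Averaging the contracted point with the same \<open>c\<close> only raises the ratio to
  \<open>(1 + t) / 2\<close>, still below 1.\<close>

lemma pulls_gjoin_self:
  assumes "pulls C M G"
  shows "pulls C M (C \<star> G)"
  unfolding pulls_def
proof
  fix m assume "m \<in> M"
  then obtain t where t: "0 \<le> t" "t < 1" "\<And>c. c \<in> C \<Longrightarrow> t *\<^sub>R c + (1 - t) *\<^sub>R m \<in> G"
    using pullsD[OF assms] by metis
  have "((1 + t) / 2) *\<^sub>R c + (1 - (1 + t) / 2) *\<^sub>R m \<in> C \<star> G" if c: "c \<in> C" for c
  proof -
    have "(1/2) *\<^sub>R c + (1 - 1/2) *\<^sub>R (t *\<^sub>R c + (1 - t) *\<^sub>R m) \<in> C \<star> G"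
      using t c by (intro gjoinI) auto
    also have "(1/2) *\<^sub>R c + (1 - 1/2) *\<^sub>R (t *\<^sub>R c + (1 - t) *\<^sub>R m) =
        (1/2 + (1 - 1/2) * t) *\<^sub>R c + ((1 - 1/2) * (1 - t)) *\<^sub>R m"
      by (simp only: scaleR_add_left scaleR_add_right scaleR_scaleR add.assoc)
    also have "\<dots> = ((1 + t) / 2) *\<^sub>R c + (1 - (1 + t) / 2) *\<^sub>R m"
      by (simp add: field_simps)
    finally show ?thesis .
  qed
  then show "\<exists>t. 0 \<le> t \<and> t < 1 \<and> (\<forall>c\<in>C. t *\<^sub>R c + (1 - t) *\<^sub>R m \<in> C \<star> G)"
    using t by (intro exI[of _ "(1 + t) / 2"]) auto
qed

text \<open>Both contractions are applied to the same \<open>c\<close>. The weight of their join can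
  be chosen so that \<open>m\<close> and \<open>m'\<close> occur in the proportion prescribed by
  \<open>x\<close>; the rest falls on \<open>c\<close>. This weight depends on \<open>l\<close>,
  \<open>t\<close> and \<open>s\<close> only, so uniformity in \<open>c\<close> survives.\<close>

lemma pulls_gjoin:
  assumes "pulls C M G" "pulls C M' G'"
  shows "pulls C (M \<star> M') (G \<star> G')"
  unfolding pulls_def
proof
  fix x assume "x \<in> M \<star> M'"
  then obtain l m m' where l: "0 < l" "l < 1" and m: "m \<in> M" "m' \<in> M'"
    and x: "x = l *\<^sub>R m + (1 - l) *\<^sub>R m'"
    by (rule gjoinE)
  obtain t where t: "0 \<le> t" "t < 1" "\<And>c. c \<in> C \<Longrightarrow> t *\<^sub>R c + (1 - t) *\<^sub>R m \<in> G"
    using pullsD[OF assms(1) m(1)] by metis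
  obtain s where s: "0 \<le> s" "s < 1" "\<And>c. c \<in> C \<Longrightarrow> s *\<^sub>R c + (1 - s) *\<^sub>R m' \<in> G'"
    using pullsD[OF assms(2) m(2)] by metis
  \<comment> \<open>The weights \<open>a\<close> and \<open>1 - a\<close> compensate the factors \<open>1 - t\<close> and \<open>1 - s\<close>, up to the
    normalization \<open>r\<close>.\<close>
  define r where "r = 1 / (l / (1 - t) + (1 - l) / (1 - s))"
  define a where "a = r * (l / (1 - t))"
  have pos: "0 < l / (1 - t)" "0 < (1 - l) / (1 - s)"
    using l t s by auto
  \<comment> \<open>Added up, these give \<open>r \<le> 1\<close>, so the new ratio
    \<open>1 - r\<close> is nonnegative; \<open>0 < r\<close> keeps it below 1.\<close>
  have ge: "l \<le> l / (1 - t)" "1 - l \<le> (1 - l) / (1 - s)"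
    using l t s by (auto simp: pos_le_divide_eq mult_left_le)
  have r: "0 < r" "r \<le> 1"
    unfolding r_def using pos ge by (auto simp: divide_le_eq)
  have a1: "1 - a = r * ((1 - l) / (1 - s))"
  proof -
    have "a + r * ((1 - l) / (1 - s)) = r * (l / (1 - t) + (1 - l) / (1 - s))"
      by (simp add: a_def distrib_left)
    also have "\<dots> = 1"
      using pos by (simp add: r_def)
    finally show ?thesis by simp
  qed
  have "0 < a" "0 < 1 - a"
    using mult_pos_pos[OF r(1) pos(1)] mult_pos_pos[OF r(1) pos(2)] unfolding a1 by (simp_all add: a_def)
  have at: "a * (1 - t) = r * l"
    using t by (simp add: a_def)
  have as: "(1 - a) * (1 - s) = r * (1 - l)"
    unfolding a1 using s by simp
  have "(1 - r) *\<^sub>R c + (1 - (1 - r)) *\<^sub>R x \<in> G \<star> G'" if c: "c \<in> C" for c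
  proof -
    have "a *\<^sub>R (t *\<^sub>R c + (1 - t) *\<^sub>R m) + (1 - a) *\<^sub>R (s *\<^sub>R c + (1 - s) *\<^sub>R m') \<in> G \<star> G'"
      using t s c \<open>0 < a\<close> \<open>0 < 1 - a\<close> by (intro gjoinI) auto
    also have "a *\<^sub>R (t *\<^sub>R c + (1 - t) *\<^sub>R m) + (1 - a) *\<^sub>R (s *\<^sub>R c + (1 - s) *\<^sub>R m') =
      (a * t + (1 - a) * s) *\<^sub>R c + ((a * (1 - t)) *\<^sub>R m + ((1 - a) * (1 - s)) *\<^sub>R m')"
      by (simp add: scaleR_add_right scaleR_add_left)
    also have "a * t + (1 - a) * s = 1 - a * (1 - t) - (1 - a) * (1 - s)"
      by (simp add: algebra_simps)
    also have "\<dots> = 1 - r"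
      unfolding at as by (simp add: algebra_simps)
    finally show ?thesis
      by (simp add: at as x scaleR_add_right)
  qed
  then show "\<exists>t. 0 \<le> t \<and> t < 1 \<and> (\<forall>c\<in>C. t *\<^sub>R c + (1 - t) *\<^sub>R x \<in> G \<star> G')"
    using r by (intro exI[of _ "1 - r"]) auto
qed

text \<open>Iterating the contraction \<open>c \<mapsto> t c + (1 - t) m\<close> moves \<open>c\<close> arbitrarily close to \<open>m\<close>;
  convexity fills in the open segment.\<close>

lemma pulls_absorb:
  assumes "convex C" "pulls C M C"
  shows "C \<star> M \<subseteq> C"
proof
  fix x assume "x \<in> C \<star> M"
  then obtain l c m where l: "0 < l" "l < 1" and c: "c \<in> C" and m: "m \<in> M"
    and x: "x = l *\<^sub>R c + (1 - l) *\<^sub>R m"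
    by (rule gjoinE)
  obtain t where t: "0 \<le> t" "t < 1" "\<And>c. c \<in> C \<Longrightarrow> t *\<^sub>R c + (1 - t) *\<^sub>R m \<in> C"
    using pullsD[OF assms(2) m] by metis
  have pow: "t ^ k *\<^sub>R c + (1 - t ^ k) *\<^sub>R m \<in> C" for k
  proof (induction k)
    case 0
    then show ?case using c by simp
  next
    case (Suc k)
    have "t *\<^sub>R (t ^ k *\<^sub>R c + (1 - t ^ k) *\<^sub>R m) + (1 - t) *\<^sub>R m \<in> C"
      by (rule t(3)[OF Suc])
    then show ?case by (simp add: algebra_simps)
  qed
  obtain k where k: "t ^ k < l"
    using real_arch_pow_inv[OF l(1) t(2)] by blast
  \<comment> \<open>Solves \<open>u + (1 - u) * t ^ k = l\<close>: between \<open>c\<close> and its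
    iterate of order \<open>k\<close>, this picks the point with weight exactly \<open>l\<close> on
    \<open>c\<close>.\<close>
  define u where "u = (l - t ^ k) / (1 - t ^ k)"
  have u: "0 \<le> u" "u \<le> 1" "0 \<le> 1 - u"
    using k l by (auto simp: u_def divide_le_eq)
  have eq: "u * (1 - t ^ k) = l - t ^ k"
    using k l by (simp add: u_def)
  have "u *\<^sub>R c + (1 - u) *\<^sub>R (t ^ k *\<^sub>R c + (1 - t ^ k) *\<^sub>R m) \<in> C"
    by (rule convexD[OF assms(1) c pow]) (use u in auto)
  also have "u *\<^sub>R c + (1 - u) *\<^sub>R (t ^ k *\<^sub>R c + (1 - t ^ k) *\<^sub>R m) =
    (u + (1 - u) * t ^ k) *\<^sub>R c + ((1 - u) * (1 - t ^ k)) *\<^sub>R m"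
    by (simp add: scaleR_add_left scaleR_add_right)
  also have "u + (1 - u) * t ^ k = l"
    using eq by (simp add: algebra_simps)
  also have "(1 - u) * (1 - t ^ k) = 1 - l"
    using eq by (simp add: algebra_simps)
  finally show "x \<in> C" by (simp add: x)
qed

text \<open>The ratio is the coefficient of \<open>x\<close>: it is \<open>E x\<close> if
  \<open>E\<close> involves \<open>x\<close>, and 0 otherwise.\<close>

lemma pulls_comb_val:
  assumes "E \<in> CL \<Omega> {}" "finite \<Omega>" "\<And>\<omega>. convex (A \<omega>)" "cofactor x {E} \<noteq> {}"
  shows "pulls (A x) (mono_val A (cofactor x {E})) (comb_val A E)"
proof (cases "0 < E x")
  case True
  then have E: "E x < 1"
    using assms(4) by (auto simp: cofactor_singleton split: if_splits)
  have "comb_val A E = (*\<^sub>R) (E x) ` A x + (*\<^sub>R) (1 - E x) ` comb_val A (residual x E)"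
    using comb_val_decompose[OF assms(1,2), of A x] assms(3) True E by (simp add: dilate_def)
  then show ?thesis
    using True E
    by (auto simp: pulls_def cofactor_singleton mono_val_singleton intro!: exI[of _ "E x"])
next
  case False
  then show ?thesis
    by (auto simp: pulls_def cofactor_singleton mono_val_singleton intro!: exI[of _ 0])
qed

text \<open>Induction on the factors. The case split is due to empty cofactors: a part consisting of
  \<open>x\<close> alone is added by \<open>pulls_gjoin_self\<close>, and two parts with nonempty
  cofactors are combined by \<open>pulls_gjoin\<close>.\<close>

lemma pulls_mono_val:
  assumes "finite N" "N \<noteq> {}" "N \<subseteq> CL \<Omega> {}" "finite \<Omega>" "\<And>\<omega>. convex (A \<omega>)" "cofactor x N \<noteq> {}"
  shows "pulls (A x) (mono_val A (cofactor x N)) (mono_val A N)"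
  using assms
proof (induction N rule: finite_ne_induct)
  case (singleton E)
  then show ?case by (auto simp: mono_val_singleton intro: pulls_comb_val)
next
  case (insert E N)
  have unit: "comb_val A F = A x" if "F \<in> CL \<Omega> {}" "cofactor x {F} = {}" for F
  proof -
    have "F x = 1"
      using that CL_le_1[OF that(1) insert.prems(2), of x]
      by (auto simp: cofactor_singleton split: if_splits)
    then show ?thesis
      using CL_eq_unit[OF that(1) insert.prems(2)] comb_val_unit by metis
  qed
  have val: "mono_val A (insert E N) = comb_val A E \<star> mono_val A N"
    using insert.hyps insert.prems by (simp add: eval_mono_def big_gjoin_insert)
  show ?case
  proof (cases "cofactor x N = {}")
    case True
    have N: "N = {unit_comb x}"
    proof (rule ccontr)
      assume "N \<noteq> {unit_comb x}"
      then have "cofactor x N \<noteq> {}"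
        using insert by (intro cofactor_nonempty) (auto simp: monomials_def)
      then show False using True by simp
    qed
    have "pulls (A x) (mono_val A (cofactor x {E})) (A x \<star> comb_val A E)"
      using insert.prems True cofactor_insert[of x E N]
      by (intro pulls_gjoin_self pulls_comb_val) auto
    then show ?thesis
      unfolding val using N True cofactor_insert[of x E N]
      by (simp add: mono_val_singleton comb_val_unit gjoin_commute)
  next
    case N: False
    then have IH: "pulls (A x) (mono_val A (cofactor x N)) (mono_val A N)"
      using insert by auto
    show ?thesis
    proof (cases "cofactor x {E} = {}")
      case True
      then show ?thesis
        unfolding val using pulls_gjoin_self[OF IH] unit insert.prems cofactor_insert[of x E N] by simp
    next
      case False
      have "mono_val A (cofactor x (insert E N)) =
          mono_val A (cofactor x {E}) \<star> mono_val A (cofactor x N)"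
        unfolding cofactor_insert[of x E N] using N False insert
        by (intro mono_val_Un) (auto simp: finite_cofactor)
      then show ?thesis
        unfolding val using insert.prems
        by (auto intro!: pulls_gjoin pulls_comb_val False IH)
    qed
  qed
qed

text \<open>Each factor \<open>rho x + (1 - rho) E\<close> with \<open>0 < rho < 1\<close> lies in
  the join of \<open>x\<close> and \<open>E\<close>. Joining over all factors, the copies of
  \<open>x\<close> collapse into one because the value of \<open>x\<close> is convex. In
  \<open>H E\<close>, the unit factor marks that \<open>E\<close> involves \<open>x\<close>.\<close>

lemma mono_val_le_join:
  assumes "N \<in> monomials \<Omega> {}" "finite \<Omega>" "\<And>\<omega>. convex (A \<omega>)" "involves x N" "cofactor x N \<noteq> {}"
  shows "mono_val A N \<subseteq> A x \<star> mono_val A (cofactor x N)"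
proof -
  have N: "finite N" "N \<noteq> {}" "N \<subseteq> CL \<Omega> {}"
    using assms by (auto simp: monomials_def)
  define H where "H E = (if 0 < E x then {unit_comb x} else {}) \<union> cofactor x {E}" for E
  have H: "finite (H E)" "H E \<noteq> {}" for E
    by (auto simp: H_def cofactor_singleton)
  have le: "comb_val A E \<subseteq> mono_val A (H E)" if E: "E \<in> N" for E
  proof -
    have ECL: "E \<in> CL \<Omega> {}" using E N by auto
    consider "\<not> 0 < E x" | "E x = 1" | "0 < E x" "E x < 1"
      using CL_le_1[OF ECL assms(2), of x] by fastforce
    then show ?thesis
    proof cases
      case 1
      then show ?thesis by (simp add: H_def cofactor_singleton mono_val_singleton)
    next
      case 2
      then show ?thesis
        using CL_eq_unit[OF ECL assms(2) 2] by (simp add: H_def cofactor_singleton mono_val_singleton)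
    next
      case 3
      have "H E = {unit_comb x} \<union> {residual x E}"
        using 3 by (auto simp: H_def cofactor_singleton)
      then have "mono_val A (H E) = A x \<star> comb_val A (residual x E)"
        using mono_val_Un[of "{unit_comb x}" "{residual x E}" A] assms(3)
        by (simp add: mono_val_singleton comb_val_unit)
      moreover have "comb_val A E = (*\<^sub>R) (E x) ` A x + (*\<^sub>R) (1 - E x) ` comb_val A (residual x E)"
        using comb_val_decompose[OF ECL assms(2), of A x] assms(3) 3 by (simp add: dilate_def)
      ultimately show ?thesis
        using 3 by (auto elim!: set_plus_elim intro: gjoinI)
    qed
  qed
  have "mono_val A N \<subseteq> big_gjoin (\<lambda>E. mono_val A (H E)) N"
    using N le unfolding eval_mono_def by (intro big_gjoin_mono) auto
  also have "\<dots> = mono_val A (\<Union>E\<in>N. H E)"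
    using N H assms(3) unfolding eval_mono_def
    by (intro big_gjoin_UN_convex[symmetric] convex_comb_val) auto
  also have "(\<Union>E\<in>N. H E) = {unit_comb x} \<union> cofactor x N"
    using assms(4) unfolding H_def involves_def by (auto simp: cofactor_def split: if_splits)
  also have "mono_val A \<dots> = A x \<star> mono_val A (cofactor x N)"
    using assms N finite_cofactor[OF N(1), of x] by (subst mono_val_Un) (auto simp: mono_val_singleton comb_val_unit)
  finally show ?thesis .
qed

text \<open>No cofactor contains \<open>unit_comb x\<close>, so deleting that marker recovers each
  cofactor exactly and the rearranged polynomial can be bypassed.\<close>

lemma cancel_rearrange:
  "cancel x (rearrange x \<phi>) = (\<Union>M\<in>free_part x \<phi>.
     insert M ((\<lambda>N. M \<union> cofactor x N) ` {N \<in> \<phi>. involves x N \<and> N \<noteq> {unit_comb x}}))"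
proof -
  define S where "S = {N \<in> \<phi>. involves x N \<and> N \<noteq> {unit_comb x}}"
  have unit: "involves x (insert (unit_comb x) M)" for M
    by (simp add: involves_def unit_comb_def)
  have re: "rearrange x \<phi> = free_part x \<phi> \<union> (\<lambda>N. insert (unit_comb x) (cofactor x N)) ` S"
    using unit[of "{}"] by (auto simp: rearrange_def free_part_def S_def)
  have free: "free_part x (rearrange x \<phi>) = free_part x \<phi>"
    unfolding re using unit by (auto simp: free_part_def)
  have "{N \<in> rearrange x \<phi>. involves x N} = (\<lambda>N. insert (unit_comb x) (cofactor x N)) ` S"
    unfolding re using unit by (auto simp: free_part_def)
  then have "(\<lambda>N. N - {unit_comb x}) ` {N \<in> rearrange x \<phi>. involves x N} = cofactor x ` S"
    using unit_notin_cofactor[of x] by (simp add: image_image)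
  then show ?thesis
    unfolding cancel_def free S_def[symmetric] by auto
qed

abbreviation reduce :: "'s \<Rightarrow> 's polynomial \<Rightarrow> 's polynomial"
  where "reduce x \<phi> \<equiv> cancel x (rearrange x \<phi>)"

lemma poly_val_reduce:
  assumes "\<phi> \<in> polynomials \<Omega> {}" "finite \<Omega>" "\<And>\<omega>. convex (A \<omega>)"
  shows "poly_val A (reduce x \<phi>) = (\<Union>M\<in>free_part x \<phi>. mono_val A M \<union>
    (\<Union>N\<in>{N \<in> \<phi>. involves x N \<and> N \<noteq> {unit_comb x}}. mono_val A M \<star> mono_val A (cofactor x N)))"
proof -
  have "mono_val A (M \<union> cofactor x N) = mono_val A M \<star> mono_val A (cofactor x N)"
    if "M \<in> free_part x \<phi>" "N \<in> \<phi>" "N \<noteq> {unit_comb x}" for M N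
    using that assms cofactor_nonempty[of N \<Omega> x]
    by (intro mono_val_Un) (auto simp: polynomials_def monomials_def free_part_def finite_cofactor)
  then have "(\<Union>M\<in>free_part x \<phi>. mono_val A M \<union>
      (\<Union>N\<in>{N \<in> \<phi>. involves x N \<and> N \<noteq> {unit_comb x}}. mono_val A (M \<union> cofactor x N))) =
    (\<Union>M\<in>free_part x \<phi>. mono_val A M \<union>
      (\<Union>N\<in>{N \<in> \<phi>. involves x N \<and> N \<noteq> {unit_comb x}}. mono_val A M \<star> mono_val A (cofactor x N)))"
    by (intro SUP_cong arg_cong2[of _ _ _ _ "(\<union>)"] refl) auto
  moreover have "poly_val A (reduce x \<phi>) = (\<Union>M\<in>free_part x \<phi>. mono_val A M \<union>
      (\<Union>N\<in>{N \<in> \<phi>. involves x N \<and> N \<noteq> {unit_comb x}}. mono_val A (M \<union> cofactor x N)))"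
    by (simp add: cancel_rearrange eval_poly_def)
  ultimately show ?thesis by simp
qed

text \<open>The value of each \<open>N\<close> lies in \<open>A x\<close>, so its cofactor pulls
  \<open>A x\<close> into itself and is absorbed by \<open>pulls_absorb\<close>. Monotonicity then
  lets a free monomial take the place of \<open>x\<close> in the join.\<close>

lemma reduce_sound:
  assumes "\<phi> \<in> polynomials \<Omega> {}" "finite \<Omega>" "\<And>\<omega>. convex (A \<omega>)" "poly_val A \<phi> \<subseteq> A x"
  shows "poly_val A (reduce x \<phi>) \<subseteq> A x"
proof -
  have le: "mono_val A M \<subseteq> A x" if "M \<in> \<phi>" for M
    using that assms(4) by (auto simp: eval_poly_def)
  have "mono_val A M \<star> mono_val A (cofactor x N) \<subseteq> A x"
    if M: "M \<in> \<phi>" and N: "N \<in> \<phi>" "N \<noteq> {unit_comb x}" for M N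
  proof -
    have N': "finite N" "N \<noteq> {}" "N \<subseteq> CL \<Omega> {}" "cofactor x N \<noteq> {}"
      using assms N cofactor_nonempty[of N \<Omega> x] by (auto simp: polynomials_def monomials_def)
    have "pulls (A x) (mono_val A (cofactor x N)) (mono_val A N)"
      by (rule pulls_mono_val[OF N'(1-3) assms(2,3) N'(4)])
    then have "pulls (A x) (mono_val A (cofactor x N)) (A x)"
      unfolding pulls_def using le[OF N(1)] by (meson subsetD)
    then have "A x \<star> mono_val A (cofactor x N) \<subseteq> A x"
      by (intro pulls_absorb assms)
    moreover have "mono_val A M \<star> mono_val A (cofactor x N) \<subseteq> A x \<star> mono_val A (cofactor x N)"
      by (intro gjoin_mono le M order_refl)
    ultimately show ?thesis by blast
  qed
  then show ?thesis
    unfolding poly_val_reduce[OF assms(1-3)] using le by (fastforce simp: free_part_def)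
qed

lemma mono_val_upd:
  assumes "M \<in> monomials \<Omega> {}" "\<And>E. E \<in> M \<Longrightarrow> \<not> 0 < E x"
  shows "mono_val (A(x := C)) M = mono_val A M"
  by (rule mono_val_cong[OF assms(1)]) (simp add: comb_val_upd assms(2))

lemma mono_val_cofactor_upd:
  "finite N \<Longrightarrow> cofactor x N \<noteq> {} \<Longrightarrow>
    mono_val (A(x := C)) (cofactor x N) = mono_val A (cofactor x N)"
  unfolding eval_mono_def
  by (intro big_gjoin_cong comb_val_upd cofactor_free[of _ x N]) (auto simp: finite_cofactor)

text \<open>The point is that the hull of the cancelled value absorbs every cofactor value
  \<open>Q\<close>. Since the hull commutes with joins, it suffices to join \<open>Q\<close> with
  the generating pieces of \<open>U\<close>. If no monomial is free of \<open>x\<close>, then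
  \<open>B x\<close> is empty and so are all joins with it.\<close>

lemma reduce_complete:
  assumes "\<phi> \<in> polynomials \<Omega> {}" "finite \<Omega>" "\<And>\<omega>. convex (A \<omega>)"
    and B: "B = A(x := convex hull (poly_val A (reduce x \<phi>)))"
  shows "poly_val B \<phi> \<subseteq> B x"
proof -
  define U where "U = poly_val A (reduce x \<phi>)"
  define S where "S = {N \<in> \<phi>. involves x N \<and> N \<noteq> {unit_comb x}}"
  have U: "U = (\<Union>M\<in>free_part x \<phi>. mono_val A M \<union>
      (\<Union>N\<in>S. mono_val A M \<star> mono_val A (cofactor x N)))"
    unfolding U_def S_def by (rule poly_val_reduce[OF assms(1-3)])
  have Bx: "B x = convex hull U" by (simp add: B U_def)
  have convB: "convex (B \<omega>)" for \<omega>
    using assms(3) by (simp add: B)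
  have mono: "M \<in> monomials \<Omega> {}" "finite M" "M \<noteq> {}" if "M \<in> \<phi>" for M
    using that assms(1) by (auto simp: polynomials_def monomials_def)
  have "mono_val B M \<subseteq> B x" if M: "M \<in> \<phi>" for M
  proof (cases "involves x M")
    case False
    then have "mono_val B M = mono_val A M"
      unfolding B using mono[OF M] by (intro mono_val_upd) (auto simp: involves_def)
    also have "\<dots> \<subseteq> U"
      using M False by (auto simp: U free_part_def)
    also have "\<dots> \<subseteq> B x"
      unfolding Bx by (rule hull_subset)
    finally show ?thesis .
  next
    case inv: True
    show ?thesis
    proof (cases "M = {unit_comb x}")
      case True
      then show ?thesis by (simp add: mono_val_singleton comb_val_unit)
    next
      case False
      then have cof: "cofactor x M \<noteq> {}"
        using mono[OF M] assms(2) by (intro cofactor_nonempty) auto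
      define Q where "Q = mono_val A (cofactor x M)"
      have convQ: "convex Q"
        unfolding Q_def using mono[OF M] cof assms(3)
        by (intro convex_mono_val) (auto simp: finite_cofactor)
      have MS: "M \<in> S" using M inv False by (simp add: S_def)
      have MQ: "mono_val A M' \<star> Q \<subseteq> U" if "M' \<in> free_part x \<phi>" for M'
        using that MS by (auto simp: U Q_def)
      have "(mono_val A M' \<star> mono_val A (cofactor x N)) \<star> Q \<subseteq> convex hull U"
        if M': "M' \<in> free_part x \<phi>" and N: "N \<in> S" for M' N
      proof -
        \<comment> \<open>Idempotence of the convex set \<open>mono_val A M'\<close> splits the triple join into two pairs,
          each of which occurs in the cancelled polynomial.\<close>
        have "convex (mono_val A M')"
          using M' mono assms(3) by (intro convex_mono_val) (auto simp: free_part_def)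
        then have "(mono_val A M' \<star> mono_val A (cofactor x N)) \<star> Q =
            (mono_val A M' \<star> mono_val A (cofactor x N)) \<star> (mono_val A M' \<star> Q)"
          by (rule gjoin_distrib_convex)
        also have "\<dots> \<subseteq> convex hull U"
        proof (rule gjoin_subset_convex[OF convex_convex_hull])
          have "mono_val A M' \<star> mono_val A (cofactor x N) \<subseteq> U"
            using M' N by (auto simp: U)
          then show "mono_val A M' \<star> mono_val A (cofactor x N) \<subseteq> convex hull U"
            using hull_subset[of U convex] by simp
          show "mono_val A M' \<star> Q \<subseteq> convex hull U"
            using MQ[OF M'] hull_subset[of U convex] by simp
        qed
        finally show ?thesis .
      qed
      moreover have "mono_val A M' \<star> Q \<subseteq> convex hull U" if "M' \<in> free_part x \<phi>" for M'
        using MQ[OF that] hull_subset[of U convex] by simp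
      \<comment> \<open>The rewriting is confined to \<open>U\<close> as a left factor of the join,
        so that \<open>U\<close> under the hull stays folded.\<close>
      ultimately have "U \<star> Q \<subseteq> convex hull U"
        unfolding U[THEN arg_cong[of _ _ "\<lambda>W. W \<star> Q"]]
        by (simp add: gjoin_UN_left gjoin_Un_left UN_subset_iff)
      then have "convex hull (U \<star> Q) \<subseteq> convex hull U"
        by (simp add: hull_minimal)
      then have "B x \<star> Q \<subseteq> B x"
        by (simp add: Bx hull_gjoin hull_same convQ)
      moreover have "mono_val B (cofactor x M) = Q"
        unfolding B Q_def using mono[OF M] cof by (intro mono_val_cofactor_upd)
      moreover have "mono_val B M \<subseteq> B x \<star> mono_val B (cofactor x M)"
        by (intro mono_val_le_join[OF mono(1)[OF M] assms(2)] convB inv cof)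
      ultimately show ?thesis by simp
    qed
  qed
  then show ?thesis by (auto simp: eval_poly_def)
qed


section \<open>Substitution\<close>

text \<open>Write \<open>E\<close> as \<open>rho x\<close> plus a convex remainder \<open>T\<close>:
  the hull moves outside, the union passes through the positive dilation, and each monomial is
  handled factor by factor. As \<open>E\<close> involves \<open>x\<close>, both sides are empty for
  the zero polynomial.\<close>

lemma comb_val_upd_hull:
  assumes "E \<in> CL \<Omega> {}" "\<phi> \<in> polynomials \<Omega> {}" "finite \<Omega>" "\<And>\<omega>. convex (A \<omega>)" "0 < E x"
  shows "comb_val (A(x := convex hull (poly_val A \<phi>))) E =
    convex hull (\<Union>K\<in>\<phi>. mono_val A ((\<lambda>F. subst_comb x F E) ` K))"
proof -
  define T where "T = dilate (1 - E x) (comb_val A (residual x E))"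
  have convT: "convex T"
    unfolding T_def by (intro convex_dilate convex_comb_val assms)
  have mono: "dilate (E x) (mono_val A K) + T = mono_val A ((\<lambda>F. subst_comb x F E) ` K)"
    if "K \<in> \<phi>" for K
  proof -
    have K: "finite K" "K \<noteq> {}" "K \<subseteq> CL \<Omega> {}"
      using that assms(2) by (auto simp: polynomials_def monomials_def)
    have "dilate (E x) (mono_val A K) + T = big_gjoin (\<lambda>F. dilate (E x) (comb_val A F) + T) K"
      unfolding eval_mono_def using K convT assms by (intro dilate_big_gjoin_plus)
    also have "\<dots> = big_gjoin (\<lambda>F. comb_val A (subst_comb x F E)) K"
      using K assms by (intro big_gjoin_cong) (auto simp: T_def comb_val_subst[of E \<Omega>])
    also have "\<dots> = mono_val A ((\<lambda>F. subst_comb x F E) ` K)"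
      unfolding eval_mono_def using K assms
      by (intro big_gjoin_image_convex[symmetric] convex_comb_val) auto
    finally show ?thesis .
  qed
  let ?B = "A(x := convex hull (poly_val A \<phi>))"
  have "comb_val ?B E = dilate (E x) (?B x) + dilate (1 - E x) (comb_val ?B (residual x E))"
    using assms by (intro comb_val_decompose) auto
  also have "\<dots> = convex hull (dilate (E x) (poly_val A \<phi>)) + convex hull T"
    by (simp add: comb_val_residual_upd T_def[symmetric] dilate_hull hull_same convT)
  also have "\<dots> = convex hull (dilate (E x) (poly_val A \<phi>) + T)"
    by (simp add: convex_hull_set_plus)
  also have "dilate (E x) (poly_val A \<phi>) + T = (\<Union>K\<in>\<phi>. dilate (E x) (mono_val A K) + T)"
    using assms(5) by (simp add: eval_poly_def dilate_UN UN_plus)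
  also have "\<dots> = (\<Union>K\<in>\<phi>. mono_val A ((\<lambda>F. subst_comb x F E) ` K))"
    using mono by simp
  finally show ?thesis .
qed

text \<open>There is no choice function into the empty set, so this formula also covers the zero
  polynomial.\<close>

lemma subst_mono_eq:
  assumes "D = {E \<in> M. 0 < E x}" "D \<noteq> {}"
  shows "subst_mono x \<phi> M = (\<lambda>h. (M - D) \<union> (\<Union>E\<in>D. (\<lambda>F. subst_comb x F E) ` h E)) ` (D \<rightarrow>\<^sub>E \<phi>)"
  using assms by (auto simp: subst_mono_def Let_def PiE_eq_empty_iff)

text \<open>The hull carried by \<open>x\<close> moves outside the join, the remaining union
  distributes over choice functions, and factors that coincide after substitution merge by
  idempotence of convex values.\<close>

lemma hull_subst_mono:
  assumes "M \<in> monomials \<Omega> {}" "\<phi> \<in> polynomials \<Omega> {}" "finite \<Omega>" "\<And>\<omega>. convex (A \<omega>)"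
  shows "convex hull (poly_val A (subst_mono x \<phi> M)) =
    convex hull (mono_val (A(x := convex hull (poly_val A \<phi>))) M)"
proof -
  let ?B = "A(x := convex hull (poly_val A \<phi>))"
  define D where "D = {E \<in> M. 0 < E x}"
  have M: "finite M" "M \<noteq> {}" "M \<subseteq> CL \<Omega> {}" and D: "finite D" "D \<subseteq> M"
    using assms(1) by (auto simp: monomials_def D_def)
  have \<phi>: "finite K" "K \<noteq> {}" "K \<subseteq> CL \<Omega> {}" if "K \<in> \<phi>" for K
    using that assms(2) by (auto simp: polynomials_def monomials_def)
  show ?thesis
  proof (cases "D = {}")
    case True
    then have "subst_mono x \<phi> M = {M}"
      by (simp add: subst_mono_def flip: D_def)
    moreover have "mono_val ?B M = mono_val A M"
      using True assms(1) by (intro mono_val_upd) (auto simp: D_def)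
    ultimately show ?thesis by (simp add: eval_poly_def)
  next
    case False
    define im where "im K E = (\<lambda>F. subst_comb x F E) ` K" for K E
    \<comment> \<open>The value of a factor after substitution with its hull left off; the hull is
      taken once, outside the join.\<close>
    define G where "G E = (if E \<in> D then \<Union>K\<in>\<phi>. mono_val A (im K E) else comb_val A E)" for E
    have "mono_val ?B M = big_gjoin (\<lambda>E. convex hull (G E)) M"
      unfolding eval_mono_def
    proof (rule big_gjoin_cong)
      fix E assume E: "E \<in> M"
      show "comb_val ?B E = convex hull (G E)"
      proof (cases "E \<in> D")
        case True
        then show ?thesis
          using comb_val_upd_hull[of E \<Omega> \<phi> A x] M assms E by (auto simp: G_def im_def D_def)
      next
        case False
        then show ?thesis
          using E assms(4) by (simp add: G_def D_def comb_val_upd hull_same convex_comb_val)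
      qed
    qed (use M in auto)
    then have hull: "mono_val ?B M = convex hull (big_gjoin G M)"
      using M by (simp add: hull_big_gjoin)
    have "big_gjoin G D = big_gjoin (\<lambda>E. \<Union>K\<in>\<phi>. mono_val A (im K E)) D"
      using D False by (intro big_gjoin_cong) (auto simp: G_def)
    also have "\<dots> = (\<Union>h\<in>D \<rightarrow>\<^sub>E \<phi>. big_gjoin (\<lambda>E. mono_val A (im (h E) E)) D)"
      using D False by (intro big_gjoin_UN_PiE)
    also have "\<dots> = (\<Union>h\<in>D \<rightarrow>\<^sub>E \<phi>. mono_val A (\<Union>E\<in>D. im (h E) E))"
    proof (rule SUP_cong[OF refl])
      fix h assume h: "h \<in> D \<rightarrow>\<^sub>E \<phi>"
      show "big_gjoin (\<lambda>E. mono_val A (im (h E) E)) D = mono_val A (\<Union>E\<in>D. im (h E) E)"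
        unfolding eval_mono_def using D False h \<phi> assms(4)
        by (intro big_gjoin_UN_convex[symmetric] convex_comb_val) (auto simp: im_def dest!: PiE_mem)
    qed
    finally have GD: "big_gjoin G D = (\<Union>h\<in>D \<rightarrow>\<^sub>E \<phi>. mono_val A (\<Union>E\<in>D. im (h E) E))" .
    have "big_gjoin G M = (\<Union>h\<in>D \<rightarrow>\<^sub>E \<phi>. mono_val A ((M - D) \<union> (\<Union>E\<in>D. im (h E) E)))"
    proof (cases "M - D = {}")
      case True
      then have "M = D" using D by blast
      then show ?thesis using GD True by simp
    next
      case rest: False
      \<comment> \<open>There is no empty join, hence the case split on the untouched factors. The
        values of \<open>G\<close> need not be convex, so the splitting rests on
        disjointness.\<close>
      have "big_gjoin G ((M - D) \<union> D) = big_gjoin G (M - D) \<star> big_gjoin G D"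
        using M D False rest by (intro big_gjoin_Un_disjoint) auto
      moreover have "(M - D) \<union> D = M" using D by blast
      moreover have "big_gjoin G (M - D) = mono_val A (M - D)"
        unfolding eval_mono_def using M rest by (intro big_gjoin_cong) (auto simp: G_def)
      ultimately have "big_gjoin G M =
          (\<Union>h\<in>D \<rightarrow>\<^sub>E \<phi>. mono_val A (M - D) \<star> mono_val A (\<Union>E\<in>D. im (h E) E))"
        using gjoin_UN_UN[of "\<lambda>_. mono_val A (M - D)" "{()}"] by (simp add: GD)
      also have "\<dots> = (\<Union>h\<in>D \<rightarrow>\<^sub>E \<phi>. mono_val A ((M - D) \<union> (\<Union>E\<in>D. im (h E) E)))"
      proof (rule SUP_cong[OF refl])
        fix h assume h: "h \<in> D \<rightarrow>\<^sub>E \<phi>"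
        then have "finite (im (h E) E)" "im (h E) E \<noteq> {}" if "E \<in> D" for E
          using that \<phi>[of "h E"] by (auto simp: im_def dest!: PiE_mem)
        then show "mono_val A (M - D) \<star> mono_val A (\<Union>E\<in>D. im (h E) E) =
            mono_val A ((M - D) \<union> (\<Union>E\<in>D. im (h E) E))"
          using M D False rest assms(4) by (intro mono_val_Un[symmetric]) auto
      qed
      finally show ?thesis .
    qed
    also have "\<dots> = poly_val A (subst_mono x \<phi> M)"
      unfolding subst_mono_eq[OF D_def False] by (simp add: eval_poly_def im_def)
    finally show ?thesis
      by (simp add: hull hull_hull)
  qed
qed

lemma hull_subst_poly:
  assumes "\<psi> \<in> polynomials \<Omega> {}" "\<phi> \<in> polynomials \<Omega> {}" "finite \<Omega>" "\<And>\<omega>. convex (A \<omega>)"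
  shows "convex hull (poly_val A (subst_poly x \<phi> \<psi>)) =
    convex hull (poly_val (A(x := convex hull (poly_val A \<phi>))) \<psi>)"
proof -
  have "poly_val A (subst_poly x \<phi> \<psi>) = (\<Union>M\<in>\<psi>. poly_val A (subst_mono x \<phi> M))"
    by (auto simp: eval_poly_def subst_poly_def)
  then have "convex hull (poly_val A (subst_poly x \<phi> \<psi>)) =
      convex hull (\<Union>M\<in>\<psi>. convex hull (poly_val A (subst_mono x \<phi> M)))"
    by (simp add: hull_UN_hull)
  also have "\<dots> = convex hull (\<Union>M\<in>\<psi>. convex hull (mono_val (A(x := convex hull (poly_val A \<phi>))) M))"
    using assms by (intro arg_cong[of _ _ "(hull) convex"] SUP_cong hull_subst_mono)
      (auto simp: polynomials_def)
  also have "\<dots> = convex hull (poly_val (A(x := convex hull (poly_val A \<phi>))) \<psi>)"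
    unfolding eval_poly_def by (rule hull_UN_hull)
  finally show ?thesis .
qed


section \<open>The eliminated symbol disappears\<close>

lemma polynomials_merge: "polynomials \<Omega>v \<Omega>p = polynomials (\<Omega>v \<union> \<Omega>p) {}"
  by (simp add: polynomials_def monomials_def CL_merge[of \<Omega>v \<Omega>p])

lemma CL_mono:
  assumes "E \<in> CL S {}" "S \<subseteq> T" "finite T"
  shows "E \<in> CL T {}"
proof -
  have "sum E T = sum E S"
    using assms by (intro sum.mono_neutral_right) (auto simp: CL_outside)
  then show ?thesis
    using assms by (auto simp: CL_def)
qed

lemma polynomials_mono:
  "\<phi> \<in> polynomials S {} \<Longrightarrow> S \<subseteq> T \<Longrightarrow> finite T \<Longrightarrow> \<phi> \<in> polynomials T {}"
  using CL_mono[of _ S T] by (fastforce simp: polynomials_def monomials_def)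

lemma CL_remove:
  assumes "E \<in> CL \<Omega> {}" "finite \<Omega>" "\<not> 0 < E x"
  shows "E \<in> CL (\<Omega> - {x}) {}"
proof -
  have Ex: "E x = 0"
    using assms CL_nonneg[OF assms(1), of x] by simp
  then have "sum E (\<Omega> - {x}) = sum E \<Omega>"
    using assms by (intro sum.mono_neutral_left) auto
  then show ?thesis
    using assms Ex by (auto simp: CL_def)
qed

text \<open>The product form covers \<open>E x = 1\<close>, where the residual vanishes and cannot
  be normalized.\<close>

lemma sum_residual:
  assumes "E \<in> CL \<Omega> {}" "finite \<Omega>"
  shows "(1 - E x) * sum (residual x E) (\<Omega> - {x}) = 1 - E x"
proof (cases "E x = 1")
  case False
  have "sum (residual x E) (\<Omega> - {x}) = sum E (\<Omega> - {x}) / (1 - E x)"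
    unfolding sum_divide_distrib by (intro sum.cong) (auto simp: residual_def)
  also have "sum E (\<Omega> - {x}) = 1 - E x"
    using assms by (cases "x \<in> \<Omega>") (auto simp: sum_diff1 CL_sum CL_outside)
  finally show ?thesis using False by simp
qed simp

lemma residual_CL:
  assumes "E \<in> CL \<Omega> {}" "finite \<Omega>" "E x < 1"
  shows "residual x E \<in> CL (\<Omega> - {x}) {}"
  using assms sum_residual[OF assms(1,2), of x] residual_outside[OF assms(1), of _ x]
  by (simp add: CL_def[of "\<Omega> - {x}"] residual_nonneg)

lemma subst_comb_CL:
  assumes "E \<in> CL \<Omega> {}" "F \<in> CL (\<Omega> - {x}) {}" "finite \<Omega>"
  shows "subst_comb x F E \<in> CL (\<Omega> - {x}) {}"
proof -
  have "sum (subst_comb x F E) (\<Omega> - {x}) =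
      E x * sum F (\<Omega> - {x}) + (1 - E x) * sum (residual x E) (\<Omega> - {x})"
    by (simp add: subst_comb_def sum.distrib sum_distrib_left)
  also have "\<dots> = 1"
    using assms by (simp add: sum_residual CL_sum)
  finally have "sum (subst_comb x F E) (\<Omega> - {x}) = 1" .
  moreover have "0 \<le> subst_comb x F E \<omega>" for \<omega>
    using assms by (simp add: subst_comb_def CL_nonneg CL_le_1 residual_nonneg)
  moreover have "subst_comb x F E \<omega> = 0" if "\<omega> \<notin> \<Omega> - {x}" for \<omega>
    using CL_outside[OF assms(2) that] residual_outside[OF assms(1) that] by (simp add: subst_comb_def)
  ultimately show ?thesis by (simp add: CL_def)
qed

lemma free_part_polynomial:
  "\<phi> \<in> polynomials \<Omega> {} \<Longrightarrow> finite \<Omega> \<Longrightarrow> free_part x \<phi> \<in> polynomials (\<Omega> - {x}) {}"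
  by (auto simp: polynomials_def monomials_def free_part_def involves_def intro!: CL_remove)

lemma cofactor_monomial:
  assumes "N \<in> monomials \<Omega> {}" "finite \<Omega>" "N \<noteq> {unit_comb x}"
  shows "cofactor x N \<in> monomials (\<Omega> - {x}) {}"
  using assms cofactor_nonempty[OF assms] residual_CL[of _ \<Omega> x] CL_remove[of _ \<Omega> x]
  by (auto simp: monomials_def finite_cofactor) (auto simp: cofactor_def)

lemma monomials_Un: "M \<in> monomials S T \<Longrightarrow> N \<in> monomials S T \<Longrightarrow> M \<union> N \<in> monomials S T"
  by (auto simp: monomials_def)

lemma reduce_polynomial:
  assumes "\<phi> \<in> polynomials \<Omega> {}" "finite \<Omega>"
  shows "reduce x \<phi> \<in> polynomials (\<Omega> - {x}) {}"
proof -
  have free: "finite (free_part x \<phi>)" "free_part x \<phi> \<subseteq> monomials (\<Omega> - {x}) {}"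
    using free_part_polynomial[OF assms] by (auto simp: polynomials_def)
  have \<phi>: "finite \<phi>" "\<phi> \<subseteq> monomials \<Omega> {}"
    using assms(1) by (auto simp: polynomials_def)
  have "M \<union> cofactor x N \<in> monomials (\<Omega> - {x}) {}"
    if "M \<in> free_part x \<phi>" "N \<in> \<phi>" "N \<noteq> {unit_comb x}" for M N
    using that free(2) \<phi>(2) assms(2) by (intro monomials_Un cofactor_monomial) auto
  then show ?thesis
    unfolding cancel_rearrange polynomials_def using free \<phi> by auto
qed

lemma subst_mono_polynomial:
  assumes "M \<in> monomials \<Omega> {}" "\<phi> \<in> polynomials (\<Omega> - {x}) {}" "finite \<Omega>"
  shows "subst_mono x \<phi> M \<in> polynomials (\<Omega> - {x}) {}"
proof -
  define D where "D = {E \<in> M. 0 < E x}"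
  have M: "finite M" "M \<noteq> {}" "\<And>E. E \<in> M \<Longrightarrow> E \<in> CL \<Omega> {}" and D: "finite D" "D \<subseteq> M"
    using assms(1) by (auto simp: monomials_def D_def)
  have rest: "M - D \<subseteq> CL (\<Omega> - {x}) {}"
    using M assms(3) by (auto simp: D_def intro: CL_remove)
  have \<phi>: "finite K" "K \<noteq> {}" "\<And>F. F \<in> K \<Longrightarrow> F \<in> CL (\<Omega> - {x}) {}" if "K \<in> \<phi>" for K
    using that assms(2) by (auto simp: polynomials_def monomials_def)
  show ?thesis
  proof (cases "D = {}")
    case True
    then have "subst_mono x \<phi> M = {M}"
      by (simp add: subst_mono_def flip: D_def)
    then show ?thesis
      using True M rest by (auto simp: polynomials_def monomials_def)
  next
    case False
    have "(M - D) \<union> (\<Union>E\<in>D. (\<lambda>F. subst_comb x F E) ` h E) \<in> monomials (\<Omega> - {x}) {}"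
      if h: "h \<in> D \<rightarrow>\<^sub>E \<phi>" for h
    proof -
      have K: "h E \<in> \<phi>" if "E \<in> D" for E
        using h that by (rule PiE_mem)
      have "subst_comb x F E \<in> CL (\<Omega> - {x}) {}" if "E \<in> D" "F \<in> h E" for E F
        using that D M \<phi>(3)[OF K] assms(3) by (intro subst_comb_CL) auto
      moreover have "finite (h E)" "h E \<noteq> {}" if "E \<in> D" for E
        using \<phi>(1,2)[OF K] that by auto
      ultimately show ?thesis
        using M D False rest by (auto simp: monomials_def)
    qed
    moreover have "finite (D \<rightarrow>\<^sub>E \<phi>)"
      using D assms(2) by (intro finite_PiE) (auto simp: polynomials_def)
    ultimately show ?thesis
      unfolding subst_mono_eq[OF D_def False] polynomials_def by auto
  qed
qed

lemma subst_poly_polynomial: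
  assumes "\<psi> \<in> polynomials \<Omega> {}" "\<phi> \<in> polynomials (\<Omega> - {x}) {}" "finite \<Omega>"
  shows "subst_poly x \<phi> \<psi> \<in> polynomials (\<Omega> - {x}) {}"
  using assms subst_mono_polynomial[OF _ assms(2,3)]
  by (fastforce simp: subst_poly_def polynomials_def)

lemma eliminate_polynomial:
  assumes "I x \<in> polynomials \<Omega> {}" "I y \<in> polynomials \<Omega> {}" "finite \<Omega>"
  shows "eliminate x I y \<in> polynomials (\<Omega> - {x}) {}"
  using assms by (simp add: eliminate_def Let_def reduce_polynomial subst_poly_polynomial)


section \<open>Elimination preserves the smallest solution\<close>

text \<open>\<open>Q\<close> fixes the symbols outside \<open>\<Omega>v\<close>, in use the hulls of
  the parameters. The set \<open>\<Omega>v\<close> stays the same at all stages: an eliminated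
  variable keeps its inequality and disappears only from right-hand sides.\<close>

definition solves ::
    "'s set \<Rightarrow> ('s \<Rightarrow> 'a::real_vector set) \<Rightarrow> 's system \<Rightarrow> ('s \<Rightarrow> 'a set) \<Rightarrow> bool"
  where "solves \<Omega>v Q I A \<longleftrightarrow> (\<forall>\<omega>. convex (A \<omega>)) \<and> (\<forall>\<omega>. \<omega> \<notin> \<Omega>v \<longrightarrow> A \<omega> = Q \<omega>) \<and>
    (\<forall>y\<in>\<Omega>v. poly_val A (I y) \<subseteq> A y)"

lemma hull_eliminate:
  assumes "I x \<in> polynomials \<Omega> {}" "I y \<in> polynomials \<Omega> {}" "finite \<Omega>" "y \<noteq> x"
    "\<And>\<omega>. convex (A \<omega>)"
  shows "convex hull (poly_val A (eliminate x I y)) =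
    convex hull (poly_val (A(x := convex hull (poly_val A (reduce x (I x))))) (I y))"
proof -
  have "reduce x (I x) \<in> polynomials \<Omega> {}"
    using reduce_polynomial[OF assms(1,3), of x] assms(3) by (auto intro: polynomials_mono)
  then show ?thesis
    using assms by (simp add: eliminate_def Let_def hull_subst_poly)
qed

text \<open>Up to hulls, the substituted inequalities evaluate the old right-hand sides at the
  smaller assignment \<open>B\<close>, so they follow by monotonicity.\<close>

lemma eliminate_sound:
  assumes "\<forall>y\<in>\<Omega>v. I y \<in> polynomials \<Omega> {}" "finite \<Omega>" "x \<in> \<Omega>v" "solves \<Omega>v Q I A"
  shows "solves \<Omega>v Q (eliminate x I) A"
proof -
  have conv: "convex (A \<omega>)" for \<omega>
    using assms(4) by (simp add: solves_def)
  have le: "poly_val A (I y) \<subseteq> A y" if "y \<in> \<Omega>v" for y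
    using assms(4) that by (simp add: solves_def)
  define B where "B = A(x := convex hull (poly_val A (reduce x (I x))))"
  have red: "poly_val A (reduce x (I x)) \<subseteq> A x"
    using assms conv le by (intro reduce_sound) auto
  then have BA: "B \<omega> \<subseteq> A \<omega>" for \<omega>
    using conv by (simp add: B_def hull_minimal)
  have "poly_val A (eliminate x I y) \<subseteq> A y" if y: "y \<in> \<Omega>v" for y
  proof (cases "y = x")
    case True
    then show ?thesis using red by (simp add: eliminate_def Let_def)
  next
    case False
    have "poly_val A (eliminate x I y) \<subseteq> convex hull (poly_val A (eliminate x I y))"
      by (rule hull_subset)
    also have "\<dots> = convex hull (poly_val B (I y))"
      unfolding B_def using assms y False conv by (intro hull_eliminate) auto
    also have "\<dots> \<subseteq> convex hull (poly_val A (I y))"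
      using assms y BA by (intro hull_mono poly_val_mono) auto
    also have "\<dots> \<subseteq> A y"
      using le y conv by (intro hull_minimal) auto
    finally show ?thesis .
  qed
  then show ?thesis
    using assms(4) by (simp add: solves_def)
qed

text \<open>Up to hulls, the old right-hand sides for \<open>y \<noteq> x\<close> at the lowered
  assignment are the new ones at \<open>A\<close>. The inequality of \<open>x\<close> itself is
  \<open>reduce_complete\<close>.\<close>

lemma eliminate_complete:
  assumes "\<forall>y\<in>\<Omega>v. I y \<in> polynomials \<Omega> {}" "finite \<Omega>" "x \<in> \<Omega>v" "solves \<Omega>v Q (eliminate x I) A"
  obtains B where "solves \<Omega>v Q I B" "\<And>\<omega>. B \<omega> \<subseteq> A \<omega>"
proof
  have conv: "convex (A \<omega>)" for \<omega>
    using assms(4) by (simp add: solves_def)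
  have le: "poly_val A (eliminate x I y) \<subseteq> A y" if "y \<in> \<Omega>v" for y
    using assms(4) that by (simp add: solves_def)
  define B where "B = A(x := convex hull (poly_val A (reduce x (I x))))"
  have "poly_val A (reduce x (I x)) \<subseteq> A x"
    using le[OF assms(3)] by (simp add: eliminate_def Let_def)
  then show "B \<omega> \<subseteq> A \<omega>" for \<omega>
    using conv by (simp add: B_def hull_minimal)
  have "poly_val B (I y) \<subseteq> B y" if y: "y \<in> \<Omega>v" for y
  proof (cases "y = x")
    case True
    have "poly_val B (I x) \<subseteq> B x"
      by (rule reduce_complete[OF _ assms(2) conv B_def]) (use assms in auto)
    then show ?thesis using True by simp
  next
    case False
    have "poly_val B (I y) \<subseteq> convex hull (poly_val B (I y))"
      by (rule hull_subset)
    also have "\<dots> = convex hull (poly_val A (eliminate x I y))"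
      unfolding B_def using assms y False conv by (intro hull_eliminate[symmetric]) auto
    also have "\<dots> \<subseteq> A y"
      using le y conv by (intro hull_minimal) auto
    finally show ?thesis using False by (simp add: B_def)
  qed
  then show "solves \<Omega>v Q I B"
    using assms(3,4) conv by (auto simp: solves_def B_def)
qed

section \<open>Iterating the elimination over all variables\<close>

lemma stage_polynomial:
  assumes "bij_betw X {1..n} \<Omega>v" "finite \<Omega>p" "\<Omega>v \<inter> \<Omega>p = {}" "\<forall>y\<in>\<Omega>v. I y \<in> polynomials \<Omega>v \<Omega>p"
    "j \<le> n" "y \<in> \<Omega>v"
  shows "stage X I j y \<in> polynomials (X ` {j<..n}) \<Omega>p"
  using assms(5,6)
proof (induction j arbitrary: y)
  case 0
  have "X ` {0<..n} = \<Omega>v"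
    using assms(1) by (simp add: bij_betw_def flip: atLeastSucAtMost_greaterThanAtMost)
  then show ?case using 0 assms(4) by simp
next
  case (Suc j)
  have x: "X (Suc j) \<in> \<Omega>v"
    using assms(1) Suc.prems by (auto simp: bij_betw_def)
  have "X ` {Suc j<..n} = X ` {j<..n} - {X (Suc j)}"
  proof -
    have "X ` ({j<..n} - {Suc j}) = X ` {j<..n} - X ` {Suc j}"
      using assms(1) Suc.prems by (intro inj_on_image_set_diff[of X "{1..n}"]) (auto simp: bij_betw_def)
    moreover have "{j<..n} - {Suc j} = {Suc j<..n}" by auto
    ultimately show ?thesis by simp
  qed
  \<comment> \<open>Disjointness guarantees that removing the eliminated variable removes no
    parameter.\<close>
  then have "X ` {Suc j<..n} \<union> \<Omega>p = (X ` {j<..n} \<union> \<Omega>p) - {X (Suc j)}"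
    using x assms(3) by auto
  moreover have "eliminate (X (Suc j)) (stage X I j) y \<in>
      polynomials ((X ` {j<..n} \<union> \<Omega>p) - {X (Suc j)}) {}"
    using Suc x assms(2) by (intro eliminate_polynomial) (auto simp: polynomials_merge[of "X ` _"])
  ultimately show ?case
    by (simp add: polynomials_merge[of "X ` _"])
qed

lemma stage_solves:
  assumes "bij_betw X {1..n} \<Omega>v" "finite \<Omega>p" "\<Omega>v \<inter> \<Omega>p = {}" "\<forall>y\<in>\<Omega>v. I y \<in> polynomials \<Omega>v \<Omega>p"
    "j \<le> n"
  shows "(\<forall>A. solves \<Omega>v Q I A \<longrightarrow> solves \<Omega>v Q (stage X I j) A) \<and>
    (\<forall>A. solves \<Omega>v Q (stage X I j) A \<longrightarrow> (\<exists>B. solves \<Omega>v Q I B \<and> (\<forall>\<omega>. B \<omega> \<subseteq> A \<omega>)))"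
  using assms(5)
proof (induction j)
  case 0
  then show ?case by auto
next
  case (Suc j)
  have x: "X (Suc j) \<in> \<Omega>v"
    using assms(1) Suc.prems by (auto simp: bij_betw_def)
  have poly: "\<forall>y\<in>\<Omega>v. stage X I j y \<in> polynomials (X ` {j<..n} \<union> \<Omega>p) {}"
    using stage_polynomial[OF assms(1-4), of j] Suc.prems by (simp flip: polynomials_merge)
  have fin: "finite (X ` {j<..n} \<union> \<Omega>p)"
    using assms(2) by simp
  have IH: "solves \<Omega>v Q I A \<Longrightarrow> solves \<Omega>v Q (stage X I j) A"
    "solves \<Omega>v Q (stage X I j) A \<Longrightarrow> \<exists>B. solves \<Omega>v Q I B \<and> (\<forall>\<omega>. B \<omega> \<subseteq> A \<omega>)" for A
    using Suc by auto
  show ?case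
  proof (intro conjI allI impI)
    fix A assume "solves \<Omega>v Q I A"
    then show "solves \<Omega>v Q (stage X I (Suc j)) A"
      using eliminate_sound[OF poly fin x IH(1)] by simp
  next
    fix A assume "solves \<Omega>v Q (stage X I (Suc j)) A"
    then obtain B where B: "solves \<Omega>v Q (stage X I j) B" "\<And>\<omega>. B \<omega> \<subseteq> A \<omega>"
      using eliminate_complete[OF poly fin x, of Q A] by auto
    then show "\<exists>B. solves \<Omega>v Q I B \<and> (\<forall>\<omega>. B \<omega> \<subseteq> A \<omega>)"
      using IH(2)[OF B(1)] by (meson subset_trans)
  qed
qed

section \<open>From the original two-sorted systems to merged convex assignments, and the smallest
  solution\<close>

lemma eval_comb_merge:
  assumes "E \<in> CL \<Omega>v \<Omega>p" "finite \<Omega>v" "finite \<Omega>p" "\<Omega>v \<inter> \<Omega>p = {}"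
  shows "eval_comb \<Omega>v \<Omega>p X P E = comb_val (\<lambda>\<omega>. if \<omega> \<in> \<Omega>v then X \<omega> else P \<omega>) E"
proof -
  let ?A = "\<lambda>\<omega>. if \<omega> \<in> \<Omega>v then X \<omega> else P \<omega>"
  have supp: "{\<omega>. 0 < E \<omega>} = {\<omega> \<in> \<Omega>v. 0 < E \<omega>} \<union> {\<omega> \<in> \<Omega>p. 0 < E \<omega>}"
    using assms(1) by (fastforce simp: CL_def)
  have "comb_val ?A E = (\<Sum>\<omega>\<in>{\<omega>. 0 < E \<omega>}. (*\<^sub>R) (E \<omega>) ` ?A \<omega>)"
    by (simp add: eval_comb_def)
  also have "\<dots> = (\<Sum>\<omega>\<in>{\<omega> \<in> \<Omega>v. 0 < E \<omega>} \<union> {\<omega> \<in> \<Omega>p. 0 < E \<omega>}. (*\<^sub>R) (E \<omega>) ` ?A \<omega>)"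
    by (simp only: supp)
  also have "\<dots> = (\<Sum>\<omega>\<in>{\<omega> \<in> \<Omega>v. 0 < E \<omega>}. (*\<^sub>R) (E \<omega>) ` ?A \<omega>) +
      (\<Sum>\<omega>\<in>{\<omega> \<in> \<Omega>p. 0 < E \<omega>}. (*\<^sub>R) (E \<omega>) ` ?A \<omega>)"
    using assms by (intro sum.union_disjoint) auto
  also have "\<dots> = eval_comb \<Omega>v \<Omega>p X P E"
    unfolding eval_comb_def using assms(4) by (intro arg_cong2[of _ _ _ _ "(+)"] sum.cong) auto
  finally show ?thesis by simp
qed

lemma eval_poly_merge:
  assumes "\<phi> \<in> polynomials \<Omega>v \<Omega>p" "finite \<Omega>v" "finite \<Omega>p" "\<Omega>v \<inter> \<Omega>p = {}"
  shows "eval_poly \<Omega>v \<Omega>p X P \<phi> = poly_val (\<lambda>\<omega>. if \<omega> \<in> \<Omega>v then X \<omega> else P \<omega>) \<phi>"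
  unfolding eval_poly_def eval_mono_def using assms
  by (intro SUP_cong big_gjoin_cong eval_comb_merge refl) (auto simp: polynomials_def monomials_def)

lemma hull_poly_val_hull:
  assumes "\<phi> \<in> polynomials \<Omega>v \<Omega>p"
  shows "convex hull (poly_val (\<lambda>\<omega>. convex hull (A \<omega>)) \<phi>) = convex hull (poly_val A \<phi>)"
proof -
  have "poly_val (\<lambda>\<omega>. convex hull (A \<omega>)) \<phi> = (\<Union>M\<in>\<phi>. convex hull (mono_val A M))"
    unfolding eval_poly_def eval_mono_def comb_val_hull using assms
    by (intro SUP_cong hull_big_gjoin[symmetric] refl) (auto simp: polynomials_def monomials_def)
  then show ?thesis
    by (simp add: hull_UN_hull eval_poly_def)
qed

text \<open>Because \<open>X y\<close> is convex, the inclusion depends only on the hull of the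
  evaluation, and that hull does not change when parameters are replaced by their hulls.\<close>

lemma is_solution_iff_solves:
  assumes "finite \<Omega>v" "finite \<Omega>p" "\<Omega>v \<inter> \<Omega>p = {}" "\<forall>y\<in>\<Omega>v. I y \<in> polynomials \<Omega>v \<Omega>p"
  shows "is_solution \<Omega>v \<Omega>p I P X \<longleftrightarrow>
    solves \<Omega>v (\<lambda>\<omega>. convex hull (P \<omega>)) I (\<lambda>\<omega>. if \<omega> \<in> \<Omega>v then X \<omega> else convex hull (P \<omega>))"
proof -
  let ?A = "\<lambda>\<omega>. if \<omega> \<in> \<Omega>v then X \<omega> else convex hull (P \<omega>)"
  have "eval_poly \<Omega>v \<Omega>p X P (I y) \<subseteq> X y \<longleftrightarrow> poly_val ?A (I y) \<subseteq> X y"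
    if conv: "\<forall>x\<in>\<Omega>v. convex (X x)" and y: "y \<in> \<Omega>v" for y
  proof -
    let ?B = "\<lambda>\<omega>. if \<omega> \<in> \<Omega>v then X \<omega> else P \<omega>"
    have "(\<lambda>\<omega>. convex hull (?B \<omega>)) = ?A"
      using conv by (auto simp: fun_eq_iff hull_same)
    then have eq: "convex hull (poly_val ?A (I y)) = convex hull (poly_val ?B (I y))"
      using hull_poly_val_hull[of "I y" \<Omega>v \<Omega>p ?B] assms(4) y by simp
    have sub: "S \<subseteq> X y \<longleftrightarrow> convex hull S \<subseteq> X y" for S
      using conv y by (metis hull_minimal hull_subset subset_trans)
    show ?thesis
      using eval_poly_merge[of "I y" \<Omega>v \<Omega>p X P] assms y eq
        sub[of "poly_val ?A (I y)"] sub[of "poly_val ?B (I y)"] by simp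
  qed
  then show ?thesis
    by (auto simp: is_solution_def solves_def)
qed

lemma ss_eq_Inter_solves:
  assumes "finite \<Omega>v" "finite \<Omega>p" "\<Omega>v \<inter> \<Omega>p = {}" "\<forall>y\<in>\<Omega>v. I y \<in> polynomials \<Omega>v \<Omega>p" "x \<in> \<Omega>v"
  shows "ss \<Omega>v \<Omega>p I P x = (\<Inter>A\<in>{A. solves \<Omega>v (\<lambda>\<omega>. convex hull (P \<omega>)) I A}. A x)"
proof
  let ?m = "\<lambda>X \<omega>. if \<omega> \<in> \<Omega>v then X \<omega> else convex hull (P \<omega>)"
  note iff = is_solution_iff_solves[OF assms(1-4), of P]
  show "ss \<Omega>v \<Omega>p I P x \<subseteq> (\<Inter>A\<in>{A. solves \<Omega>v (\<lambda>\<omega>. convex hull (P \<omega>)) I A}. A x)"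
  proof (intro INT_greatest)
    fix A assume "A \<in> {A. solves \<Omega>v (\<lambda>\<omega>. convex hull (P \<omega>)) I A}"
    moreover from this have "?m A = A"
      by (auto simp: solves_def fun_eq_iff)
    ultimately have "is_solution \<Omega>v \<Omega>p I P A"
      using iff[of A] by simp
    then show "ss \<Omega>v \<Omega>p I P x \<subseteq> A x"
      by (auto simp: ss_def)
  qed
  show "(\<Inter>A\<in>{A. solves \<Omega>v (\<lambda>\<omega>. convex hull (P \<omega>)) I A}. A x) \<subseteq> ss \<Omega>v \<Omega>p I P x"
    unfolding ss_def
  proof (intro INT_greatest)
    fix X assume "X \<in> {X. is_solution \<Omega>v \<Omega>p I P X}"
    then have "?m X \<in> {A. solves \<Omega>v (\<lambda>\<omega>. convex hull (P \<omega>)) I A}"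
      using iff by simp
    then have "(\<Inter>A\<in>{A. solves \<Omega>v (\<lambda>\<omega>. convex hull (P \<omega>)) I A}. A x) \<subseteq> ?m X x"
      by (rule INT_lower)
    then show "(\<Inter>A\<in>{A. solves \<Omega>v (\<lambda>\<omega>. convex hull (P \<omega>)) I A}. A x) \<subseteq> X x"
      using assms(5) by simp
  qed
qed

text \<open>After the last stage the right-hand sides read parameters only, so the lower bounds
  \<open>R\<close> are common to all admissible assignments, and \<open>S\<close>, built from them,
  is the least solution of the final system.\<close>

lemma ss_eq_hull_stage:
  assumes "bij_betw X {1..n} \<Omega>v" "finite \<Omega>p" "\<Omega>v \<inter> \<Omega>p = {}" "\<forall>y\<in>\<Omega>v. I y \<in> polynomials \<Omega>v \<Omega>p"
    "x \<in> \<Omega>v"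
  shows "ss \<Omega>v \<Omega>p I P x = convex hull (eval_par \<Omega>p P (stage X I n x))"
proof -
  define Q where "Q = (\<lambda>\<omega>. convex hull (P \<omega>))"
  define R where "R y = convex hull (eval_par \<Omega>p P (stage X I n y))" for y
  define S where "S = (\<lambda>\<omega>. if \<omega> \<in> \<Omega>v then R \<omega> else Q \<omega>)"
  have fin: "finite \<Omega>v"
    using assms(1) bij_betw_finite by blast
  have poly: "stage X I n y \<in> polynomials {} \<Omega>p" if "y \<in> \<Omega>v" for y
    using stage_polynomial[OF assms(1-4), of n y] that by simp
  have val: "convex hull (poly_val A (stage X I n y)) = R y"
    if "y \<in> \<Omega>v" "\<And>\<omega>. \<omega> \<notin> \<Omega>v \<Longrightarrow> A \<omega> = Q \<omega>" for A y
  proof -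
    have "poly_val A (stage X I n y) = poly_val Q (stage X I n y)"
      unfolding eval_poly_def
    proof (intro SUP_cong mono_val_cong comb_val_cong refl)
      fix M E \<omega> assume "M \<in> stage X I n y" "E \<in> M" "0 < E \<omega>"
      then have "\<omega> \<in> \<Omega>p"
        using poly[OF that(1)] by (fastforce simp: polynomials_def monomials_def CL_def)
      then show "A \<omega> = Q \<omega>" using that(2) assms(3) by blast
    next
      fix M assume "M \<in> stage X I n y"
      then show "M \<in> monomials \<Omega>p {}"
        using poly[OF that(1)] by (auto simp: polynomials_def monomials_def CL_merge[of "{}"])
    qed
    then show ?thesis
      using hull_poly_val_hull[OF poly[OF that(1)], of P]
        eval_poly_merge[OF poly[OF that(1)] finite.emptyI assms(2), of "\<lambda>_. {}" P]
      by (simp add: R_def Q_def)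
  qed
  have "R y \<subseteq> A y" if "solves \<Omega>v Q (stage X I n) A" "y \<in> \<Omega>v" for A y
  proof -
    have "convex hull (poly_val A (stage X I n y)) \<subseteq> A y"
      using that by (intro hull_minimal) (auto simp: solves_def)
    then show ?thesis
      using val[of y A] that by (simp add: solves_def)
  qed
  then have lower: "R x \<subseteq> A x" if "solves \<Omega>v Q I A" for A
    using stage_solves[OF assms(1-4), of n Q] that assms(5) by blast
  have "poly_val S (stage X I n y) \<subseteq> S y" if "y \<in> \<Omega>v" for y
    using val[OF that, of S] hull_subset[of "poly_val S (stage X I n y)" convex] that by (simp add: S_def)
  then have "solves \<Omega>v Q (stage X I n) S"
    by (auto simp: solves_def S_def R_def Q_def)
  \<comment> \<open>Nothing shows yet that \<open>S\<close> solves the original system; a solution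
    \<open>B\<close> below it suffices, since \<open>lower\<close> gives the reverse inclusion at
    \<open>x\<close>.\<close>
  then obtain B where B: "solves \<Omega>v Q I B" "B x \<subseteq> S x"
    using stage_solves[OF assms(1-4), of n Q] by blast
  have "ss \<Omega>v \<Omega>p I P x = (\<Inter>A\<in>{A. solves \<Omega>v Q I A}. A x)"
    unfolding Q_def by (rule ss_eq_Inter_solves[OF fin assms(2-5)])
  also have "\<dots> = R x"
    using lower B assms(5) by (auto simp: S_def)
  finally show ?thesis by (simp add: R_def)
qed

theorem theorem3:
  fixes n :: nat
    and X :: "nat \<Rightarrow> 's"
    and \<Omega>v \<Omega>p :: "'s set"
    and I :: "'s system"
  assumes fin_dim: "\<exists>B :: 'a::real_vector set. finite B \<and> span B = UNIV"
    and variables: "bij_betw X {1..n} \<Omega>v"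
    and parameters: "finite \<Omega>p" "\<Omega>v \<inter> \<Omega>p = {}"
    and system: "\<forall>i\<in>{1..n}. I (X i) \<in> polynomials \<Omega>v \<Omega>p"
  shows "(\<forall>j\<le>n. \<forall>i\<in>{1..n}. stage X I j (X i) \<in> polynomials (X ` {j<..n}) \<Omega>p) \<and>
    (\<forall>i\<in>{1..n}. stage X I n (X i) \<in> polynomials {} \<Omega>p) \<and>
    (\<forall>j\<in>{1..n}. \<forall>P :: 's \<Rightarrow> 'a set.
      ss \<Omega>v \<Omega>p I P (X j) = convex hull (eval_par \<Omega>p P (stage X I n (X j))))"
proof -
  have \<Omega>v: "\<Omega>v = X ` {1..n}"
    using variables by (simp add: bij_betw_def)
  have poly: "\<forall>y\<in>\<Omega>v. I y \<in> polynomials \<Omega>v \<Omega>p"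
    using system by (auto simp: \<Omega>v)
  have stage: "stage X I j (X i) \<in> polynomials (X ` {j<..n}) \<Omega>p" if "j \<le> n" "i \<in> {1..n}" for i j
    using stage_polynomial[OF variables parameters poly that(1)] that(2) \<Omega>v by blast
  moreover have "stage X I n (X i) \<in> polynomials {} \<Omega>p" if "i \<in> {1..n}" for i
    using stage[OF order_refl that] by simp
  moreover have "ss \<Omega>v \<Omega>p I P (X j) = convex hull (eval_par \<Omega>p P (stage X I n (X j)))"
    if "j \<in> {1..n}" for j and P :: "'s \<Rightarrow> 'a set"
    using ss_eq_hull_stage[OF variables parameters poly] that \<Omega>v by blast
  ultimately show ?thesis by blast
qed

end
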